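(* Let $\sigma\in\mathbb{C}$ and let $A=(a_1,\ldots,a_q)$, $B=(b_1,\ldots,b_q)$ be complex vectors. Suppose $\Re\left(\sum_{i=1}^{q}(b_i-a_i)\right)+1>\Re(\sigma)$ and $\Re(a_i)>0$ for $i=1,\ldots,q$. Then for $|\arg(1+z)|<\pi$ $$ {}_{q+1}F_q(\sigma,A;B;-z)=\int_{0}^{1}\frac{\rho_1(s)\,ds}{1+sz}, $$ with $$ \rho_1(s)=\frac{1}{\Gamma(\sigma)}\left(\prod_{i=1}^{q}\frac{\Gamma(b_i)}{\Gamma(a_i)}\right)\frac{1}{s}\,G^{q+1,0}_{q+1,q+1}\left(s\,\Big|\begin{array}{c}1,B\\ \sigma,A\end{array}\right). $$
   Context: The generalized hypergeometric function is ${}_{q+1}F_q(\sigma,A;B;z)=\sum_{n=0}^{\infty}\frac{(\sigma)_n(a_1)_n\cdots(a_q)_n}{(b_1)_n\cdots(b_q)_n\,n!}z^n$ for $|z|<1$, extended by analytic continuation to the complex plane cut along $[1,\infty)$; here $(a)_0=1$ and $(a)_n=a(a+1)\cdots(a+n-1)$ for $n\ge1$. For complex vectors $C=(c_1,\ldots,c_p)$, $D=(d_1,\ldots,d_p)$ and $x>0$, Meijer's function is $$G^{p,0}_{p,p}\left(x\,\Big|\begin{array}{c}D\\C\end{array}\right)=\frac{1}{2\pi i}\int_{\gamma-i\infty}^{\gamma+i\infty}\frac{\Gamma(c_1+s)\cdots\Gamma(c_p+s)}{\Gamma(d_1+s)\cdots\Gamma(d_p+s)}x^{-s}\,ds,\qquad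 \gamma>-\min(\Re c_1,\ldots,\Re c_p),$$ the integral being understood as $\lim_{R\to\infty}\int_{\gamma-iR}^{\gamma+iR}$. In the claim $p=q+1$, $D=(1,b_1,\ldots,b_q)$ and $C=(\sigma,a_1,\ldots,a_q)$.
   Formalization: The hypothesis Re(σ) > 0 is added, since without it the claim fails (q = 0, σ = −1/2: the integral diverges at 0); the b_i are also explicitly assumed not to be non-positive integers. *)

theory Defs
  imports "HOL-Complex_Analysis.Complex_Analysis"
begin

text \<open>
  Complex vectors are lists. The hypergeometric function is the analytic continuation of
  its power series from the unit disc to the cut plane. The cut plane is connected, so
  the continuation, if it exists, is unique there; values on the cut carry no meaning.
\<close>

definition cut_plane :: "complex set" where
  "cut_plane = - (complex_of_real ` {1..})"

definition hypergeo :: "complex list \<Rightarrow> complex list \<Rightarrow> complex \<Rightarrow> complex" where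
  "hypergeo as bs z =
     (THE w. \<exists>f. f holomorphic_on cut_plane \<and>
                 (\<forall>u\<in>ball 0 1. f u = eval_fps (fps_hypergeo as bs 1) u) \<and>
                 w = f z)"

text \<open>
  The Mellin-Barnes integral over the vertical segment from \<open>\<gamma> - iR\<close> to \<open>\<gamma> + iR\<close>. Where
  \<open>d + s\<close> is a pole of \<open>Gamma\<close>, the library's values \<open>Gamma (d + s) = 0\<close> and \<open>w / 0 = 0\<close>
  give the value \<open>0\<close> of the entire function \<open>1 / Gamma\<close>.
\<close>

definition meijer_G_trunc ::
    "complex list \<Rightarrow> complex list \<Rightarrow> real \<Rightarrow> real \<Rightarrow> real \<Rightarrow> complex" where
  "meijer_G_trunc D C x \<gamma> R =
     1 / (2 * of_real pi * \<i>) *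
     contour_integral (linepath (Complex \<gamma> (- R)) (Complex \<gamma> R))
       (\<lambda>s. (\<Prod>c\<leftarrow>C. Gamma (c + s)) / (\<Prod>d\<leftarrow>D. Gamma (d + s)) * of_real x powr (- s))"

text \<open>
  Meijer's function with upper row \<open>D\<close> and lower row \<open>C\<close>, both of length \<open>p\<close>, orders
  \<open>(p, 0)\<close> and \<open>(p, p)\<close>, for \<open>x > 0\<close>. It is the common value of the principal value
  integrals over all admissible abscissas \<open>\<gamma>\<close>.
\<close>

definition meijer_G :: "complex list \<Rightarrow> complex list \<Rightarrow> real \<Rightarrow> complex" where
  "meijer_G D C x =
     (THE g. \<forall>\<gamma>. \<gamma> > - Min (Re ` set C) \<longrightarrow> (meijer_G_trunc D C x \<gamma> \<longlongrightarrow> g) at_top)"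

definition rho1 :: "complex \<Rightarrow> complex list \<Rightarrow> complex list \<Rightarrow> real \<Rightarrow> complex" where
  "rho1 \<sigma> A B s =
     1 / Gamma \<sigma> * (\<Prod>i<length A. Gamma (B ! i) / Gamma (A ! i)) *
     (1 / of_real s) * meijer_G (1 # B) (\<sigma> # A) s"

end

theory Submission
  imports Defs
begin

text \<open>
  Let \<open>\<phi> s = \<Prod>\<Gamma>(c + s) / \<Prod>\<Gamma>(d + s)\<close> be the kernel of Meijer's function \<open>G\<close>. In a half-plane
  \<open>Re s \<ge> \<gamma>\<close> to the right of all poles, \<open>\<phi> s = O(\<bar>s\<bar>\<^sup>-\<^sup>\<epsilon>)\<close> and \<open>\<phi>' s = O(\<bar>s\<bar>\<^sup>-\<^sup>1\<^sup>-\<^sup>\<epsilon>)\<close> for some \<open>\<epsilon> > 0\<close>,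
  because the sum of the \<open>d\<close> exceeds that of the \<open>c\<close> in real part. Integration by parts
  turns the conditionally convergent integral for \<open>G(x)\<close>, \<open>0 < x < 1\<close>, into an absolutely convergent
  one, and it bounds the truncated integrals, uniformly in the truncation, by a multiple of
  \<open>x\<^sup>-\<^sup>\<gamma>(1 - x)\<^sup>\<epsilon>\<^sup>-\<^sup>1\<close>. By dominated convergence and Fubini the Mellin transform of \<open>G\<close> on \<open>(0, 1)\<close>
  is therefore the limit of \<open>1/(2\<pi>i) \<integral> \<phi>(w)/(s - w) dw\<close>, which is \<open>\<phi> s\<close> by Cauchy's formula on growing
  rectangles. Hence the moments of \<open>\<rho>\<^sub>1\<close> are the hypergeometric coefficients; the Stieltjes transform
  of \<open>\<rho>\<^sub>1\<close> agrees with the power series in the unit disc and is holomorphic in the cut plane.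
\<close>

section \<open>Quotients of Gamma functions in a sector\<close>

text \<open>The excess of the \<open>d\<close> over the \<open>c\<close> may be arbitrarily small,
  so the kernel need not be absolutely integrable on a vertical line and Fubini cannot be applied to
  the full inversion integral. Only truncated integrals are interchanged; the truncation is removed
  afterwards. One derivative gains a full power of |s|, which is just enough for integrability. All
  contours close to the right, where the kernel has no poles. Thus no residue series over poles of
  Gamma arises, and coincidences among the parameters need no separate treatment. Gamma enters only
  through the growth of quotients, obtained from Euler's limit and the functional equation instead
  of Stirling's formula. The majorant is singular at x = 1 because the frequency -ln x of x^(-s)
  vanishes there; \<epsilon> > 0 is exactly what keeps (1 - x)^(\<epsilon> - 1) integrable. The
  factor 1/s in \<open>rho1\<close> makes the moment of order n the Mellin transform at n. As all
  \<open>c\<close> have positive real part, n = 0 still lies inside the half-plane.\<close>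

lemma second_order_bound:
  fixes G :: "complex \<Rightarrow> complex"
  assumes "0 < r" "G holomorphic_on ball 0 r" "(G has_field_derivative 0) (at 0)"
  obtains C \<delta> where "0 < \<delta>" "0 \<le> C" "\<And>w. norm w \<le> \<delta> \<Longrightarrow> norm (G w - G 0) \<le> C * (norm w)^2"
proof -
  define \<delta> where "\<delta> = r / 2"
  have \<delta>: "0 < \<delta>" "cball 0 \<delta> \<subseteq> ball (0::complex) r" using assms(1) by (auto simp: \<delta>_def)
  have op: "open (ball (0::complex) r)" by simp
  have h1: "deriv G holomorphic_on ball 0 r" and h2: "deriv (deriv G) holomorphic_on ball 0 r"
    using assms(2) op by (auto intro!: holomorphic_deriv)
  have "compact (deriv (deriv G) ` cball 0 \<delta>)"
    by (intro compact_continuous_image continuous_on_subset[OF holomorphic_on_imp_continuous_on[OF h2]] \<delta>)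
      auto
  then obtain C where C: "\<And>w. w \<in> cball 0 \<delta> \<Longrightarrow> norm (deriv (deriv G) w) \<le> C"
    by (meson bounded_iff compact_imp_bounded image_eqI)
  have der: "((\<lambda>w. (deriv ^^ i) G w) has_field_derivative (deriv ^^ Suc i) G x) (at x within cball 0 \<delta>)"
    if "x \<in> cball 0 \<delta>" "i \<le> 1" for i x
  proof -
    have "(deriv ^^ i) G holomorphic_on ball 0 r"
      using assms(2) op by (intro holomorphic_higher_deriv) auto
    hence "((deriv ^^ i) G has_field_derivative deriv ((deriv ^^ i) G) x) (at x within cball 0 \<delta>)"
      using that \<delta>(2) op by (intro holomorphic_derivI) auto
    thus ?thesis by simp
  qed
  have d0: "deriv G 0 = 0" using assms(3) by (rule DERIV_imp_deriv)
  show ?thesis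
  proof (rule that[of \<delta> C])
    show "0 \<le> C" by (rule order.trans[OF norm_ge_zero C[of 0]]) (use \<delta>(1) in auto)
    fix w :: complex assume w: "norm w \<le> \<delta>"
    have "norm ((deriv ^^ 0) G w - (\<Sum>i\<le>1. (deriv ^^ i) G 0 * (w - 0) ^ i / (fact i)))
        \<le> C * norm (w - 0) ^ (Suc 1) / fact 1"
      by (rule complex_Taylor[of "cball 0 \<delta>"]) (use der C w \<delta> in \<open>auto simp: numeral_2_eq_2\<close>)
    thus "norm (G w - G 0) \<le> C * (norm w)^2"
      by (simp add: d0 power2_eq_square)
  qed (use \<delta> in auto)
qed

text \<open>The hypothesis describes the sector |arg s| <= 2 pi / 3. There the cross term 2k Re s of
  the square is at least -k|s|, hence at least -(|s|^2 + k^2) / 2. So shifts to the right never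
  approach 0, and their size is controlled by |s| and k together.\<close>

lemma norm_add_of_nat_sector:
  fixes s :: complex
  assumes "- norm s / 2 \<le> Re s"
  shows "((norm s)^2 + (real k)^2) / 2 \<le> (norm (s + of_nat k))^2"
proof -
  have "(norm (s + of_nat k))^2 = (norm s)^2 + 2 * real k * Re s + (real k)^2"
    by (simp only: cmod_power2) (simp add: power2_eq_square algebra_simps)
  moreover have "2 * real k * Re s \<ge> - (real k * norm s)"
    using mult_left_mono[OF assms, of "2 * real k"] by simp
  moreover have "2 * (real k * norm s) \<le> (norm s)^2 + (real k)^2"
    using sum_squares_bound[of "real k" "norm s"] by (simp add: mult.assoc)
  ultimately show ?thesis by (simp add: field_simps)
qed

lemma norm_add_of_nat_sector':
  fixes s :: complex
  assumes "- norm s / 2 \<le> Re s"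
  shows "norm s / 2 \<le> norm (s + of_nat k)"
proof (rule power2_le_imp_le)
  have "(norm s / 2)^2 = (norm s)^2 / 4" by (simp add: power_divide)
  also have "\<dots> \<le> ((norm s)^2 + (real k)^2) / 2" by simp
  also have "\<dots> \<le> (norm (s + of_nat k))^2" by (rule norm_add_of_nat_sector[OF assms])
  finally show "(norm s / 2)^2 \<le> (norm (s + of_nat k))^2" .
qed simp

text \<open>The imaginary parts of s and 1 + 1/s have opposite signs, so the sum of the two
  arguments stays in (-pi, pi] and no multiple of 2 pi i appears.\<close>

lemma Ln_add_one:
  fixes s :: complex
  assumes "s \<notin> \<real>\<^sub>\<le>\<^sub>0"
  shows "Ln (s + 1) = Ln s + Ln (1 + 1 / s)"
proof -
  have s0: "s \<noteq> 0" using assms by auto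
  have eq: "s * (1 + 1/s) = s + 1" using s0 by (simp add: field_simps)
  have nz: "1 + 1/s \<noteq> 0"
  proof
    assume "1 + 1/s = 0"
    hence "s = -1" using s0 by (simp add: field_simps add_eq_0_iff2 minus_equation_iff)
    thus False using assms by (auto simp: complex_nonpos_Reals_iff)
  qed
  have im: "Im (1 + 1/s) = - Im s / (norm s)^2"
    using s0 by (simp add: Im_divide cmod_power2)
  consider "Im s > 0" | "Im s < 0" | "Im s = 0" "Re s > 0"
    using assms by (force simp: complex_nonpos_Reals_iff)
  hence "- pi < Im (Ln s) + Im (Ln (1 + 1/s)) \<and> Im (Ln s) + Im (Ln (1 + 1/s)) \<le> pi"
  proof cases
    case 1
    hence "Im (1 + 1/s) < 0" using s0 using 1 s0 by (simp only: im) simp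
    hence "\<not> (0 \<le> Im (Ln (1+1/s)))" using Im_Ln_pos_le[OF nz] Im_Ln_le_pi[OF nz] by auto
    thus ?thesis using Im_Ln_pos_lt_imp[OF 1] mpi_less_Im_Ln[OF nz] by linarith
  next
    case 2
    hence "Im (1 + 1/s) > 0" using s0 2 by (simp only: im) (simp add: divide_neg_pos)
    moreover have "\<not> (0 \<le> Im (Ln s))" using 2 Im_Ln_pos_le[OF s0] Im_Ln_le_pi[OF s0] by auto
    ultimately show ?thesis using Im_Ln_pos_lt_imp mpi_less_Im_Ln[OF s0] by (smt (verit))
  next
    case 3
    hence "Im (1 + 1/s) = 0" by (simp only: im)
    moreover have "Re (1 + 1/s) > 0" using 3 by (simp add: Re_divide add_pos_nonneg)
    ultimately have "Im (Ln (1+1/s)) = 0" using Im_Ln_eq_0[OF nz] by simp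
    moreover have "Im (Ln s) = 0" using Im_Ln_eq_0[OF s0] 3 by simp
    ultimately show ?thesis by simp
  qed
  thus ?thesis using Ln_times_simple[OF s0 nz] eq by simp
qed

text \<open>The quotient of Gamma functions divided by its expected growth s^(c - d). The factor
  \<open>rGamma\<close> keeps it meaningful at the poles of the denominator.\<close>

definition Gamma_quot :: "complex \<Rightarrow> complex \<Rightarrow> complex \<Rightarrow> complex" where
  "Gamma_quot c d s = Gamma (c + s) * rGamma (d + s) * exp ((d - c) * Ln s)"

text \<open>Euler's limit for both Gamma functions: after the \<open>Gamma_series\<close> are split
  off, only a power of (s + n + 1) / n remains. The shift is by n + 1 because the
  \<open>pochhammer\<close> in \<open>Gamma_series\<close> has n + 1 factors.\<close>

lemma Gamma_quot_tendsto_1: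
  assumes "c + s \<notin> \<int>\<^sub>\<le>\<^sub>0" "d + s \<notin> \<int>\<^sub>\<le>\<^sub>0"
  shows "(\<lambda>n. Gamma_quot c d (s + of_nat (Suc n))) \<longlonglongrightarrow> 1"
proof -
  have g: "Gamma (c + s) \<noteq> 0" "Gamma (d + s) \<noteq> 0" using assms by (auto simp: Gamma_eq_zero_iff)
  have A: "(\<lambda>n. Gamma (c+s) / Gamma_series (c+s) n * (Gamma_series (d+s) n / Gamma (d+s)) *
           exp ((d - c) * Ln ((s + of_nat (Suc n)) / of_nat n))) \<longlonglongrightarrow>
         Gamma (c+s) / Gamma (c+s) * (Gamma (d+s) / Gamma (d+s)) * exp ((d-c) * Ln 1)"
  proof (intro tendsto_intros g)
    have "(\<lambda>n. (s + 1) * inverse (of_nat n) + 1) \<longlonglongrightarrow> (s + 1) * 0 + 1"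
      by (intro tendsto_intros lim_inverse_n)
    moreover have "eventually (\<lambda>n. (s + 1) * inverse (of_nat n) + 1 = (s + of_nat (Suc n)) / of_nat n) sequentially"
      using eventually_gt_at_top[of "0::nat"]
      by eventually_elim (simp add: field_simps)
    ultimately show "(\<lambda>n. (s + of_nat (Suc n)) / of_nat n) \<longlonglongrightarrow> 1"
      using Lim_transform_eventually by fastforce
  qed auto
  have "eventually (\<lambda>n. norm s < of_nat n) sequentially"
    using filterlim_real_sequentially unfolding filterlim_at_top_dense by blast
  with eventually_gt_at_top[of "0::nat"]
  have "eventually (\<lambda>n. Gamma (c+s) / Gamma_series (c+s) n * (Gamma_series (d+s) n / Gamma (d+s)) *
           exp ((d - c) * Ln ((s + of_nat (Suc n)) / of_nat n)) =
         Gamma_quot c d (s + of_nat (Suc n))) sequentially"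
  proof eventually_elim
    case (elim n)
    have nz: "s + of_nat (Suc n) \<noteq> 0"
    proof
      assume "s + of_nat (Suc n) = 0"
      hence "s = - of_nat (Suc n)" by (simp add: add_eq_0_iff2)
      hence "norm s = of_nat (Suc n)" by (simp only: norm_minus_cancel norm_of_nat)
      thus False using elim by simp
    qed
    have L: "Ln ((s + of_nat (Suc n)) / of_nat n) = Ln (s + of_nat (Suc n)) - of_real (ln (real n))"
      using Ln_divide_of_real[of "real n", OF _ nz] elim by simp
    have p: "pochhammer (c+s) (Suc n) \<noteq> 0" "pochhammer (d+s) (Suc n) \<noteq> 0"
      using assms pochhammer_eq_0_imp_nonpos_Int by blast+
    have G1: "Gamma (c + (s + of_nat (Suc n))) = Gamma (c+s) * pochhammer (c+s) (Suc n)"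
      using pochhammer_Gamma[OF assms(1), of "Suc n"] g by (simp add: add_ac)
    have G2: "Gamma (d + (s + of_nat (Suc n))) = Gamma (d+s) * pochhammer (d+s) (Suc n)"
      using pochhammer_Gamma[OF assms(2), of "Suc n"] g by (simp add: add_ac)
    show ?case
      unfolding Gamma_quot_def G1 G2 L rGamma_inverse_Gamma Gamma_series_def
      using g p by (simp add: field_simps exp_diff exp_add ring_distribs)
  qed
  from Lim_transform_eventually[OF A this] g show ?thesis by simp
qed

text \<open>Functional equation of both Gamma functions, together with \<open>Ln_add_one\<close>.
  The factor is written in w = 1/s, so that its expansion at w = 0 can be used for large s.\<close>

lemma Gamma_quot_step:
  assumes s: "s \<notin> \<real>\<^sub>\<le>\<^sub>0" and c: "c + s \<notin> \<int>\<^sub>\<le>\<^sub>0"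
  shows "Gamma_quot c d s = Gamma_quot c d (s + 1) *
     (exp ((c - d) * Ln (1 + 1/s)) * (1 + d * (1/s)) / (1 + c * (1/s)))"
proof -
  have s0: "s \<noteq> 0" using s by auto
  have c0: "c + s \<noteq> 0" using c by auto
  have "Gamma (c + (s + 1)) = (c + s) * Gamma (c + s)"
    using Gamma_plus1[OF c] by (simp add: add_ac)
  moreover have "rGamma (d + s) = (d + s) * rGamma (d + (s + 1))"
    using rGamma_plus1[of "d + s"] by (simp add: add_ac)
  moreover have "exp ((d - c) * Ln s) = exp ((d - c) * Ln (s + 1)) * exp ((c - d) * Ln (1 + 1/s))"
    unfolding Ln_add_one[OF s] by (simp flip: exp_add add: algebra_simps)
  moreover have "(1 + d * (1/s)) / (1 + c * (1/s)) = (d + s) / (c + s)"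
  proof -
    have "1 + d * (1/s) = (d + s) / s" "1 + c * (1/s) = (c + s) / s"
      using s0 by (simp_all add: field_simps)
    thus ?thesis using s0 by simp
  qed
  ultimately show ?thesis
    unfolding Gamma_quot_def using c0
    by (simp only: times_divide_eq_right[symmetric] mult.assoc) (simp add: field_simps)
qed

lemma summable_inverse_one_plus_square: "summable (\<lambda>k. 2 / (1 + (real k)^2))"
proof (rule summable_comparison_test_ev)
  show "eventually (\<lambda>k. norm (2 / (1 + (real k)^2)) \<le> 2 / (real k)^2) sequentially"
    using eventually_gt_at_top[of 0] by eventually_elim (auto intro!: frac_le)
  show "summable (\<lambda>k. 2 / (real k)^2)"
    using summable_mult[OF inverse_power_summable[of 2, where 'a=real], of 2] by (simp add: field_simps)
qed

text \<open>
  \<open>Gamma_quot c d s\<close> differs from \<open>Gamma_quot c d (s + 1)\<close> by the factor \<open>G (1 / s)\<close>, where \<open>G\<close> is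
  holomorphic near \<open>0\<close> with \<open>G 0 = 1\<close> and \<open>G' 0 = 0\<close>. So the factors along \<open>s, s + 1, \<dots>\<close> are
  \<open>1 + O(1 / (1 + k\<^sup>2))\<close>, uniformly in \<open>s\<close>, and their product telescopes to the limit \<open>1\<close>.
\<close>

lemma Gamma_quot_bounded:
  obtains M R where "0 < R" "0 \<le> M" "norm c < R"
    "\<And>s. R \<le> norm s \<Longrightarrow> - norm s / 2 \<le> Re s \<Longrightarrow> norm (Gamma_quot c d s) \<le> M"
proof -
  define G where "G = (\<lambda>w. exp ((c - d) * Ln (1 + w)) * (1 + d * w) / (1 + c * w))"
  \<comment> \<open>For |w| < r the denominator 1 + cw has no zero, and since r <= 1 the point 1 + w
    avoids the cut of \<open>Ln\<close>.\<close>
  define r where "r = 1 / (1 + norm c)"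
  have r: "0 < r" "r \<le> 1" by (auto simp: r_def add_pos_nonneg)
  have nz: "1 + c * w \<noteq> 0" if "norm w < r" for w
  proof
    assume "1 + c * w = 0"
    hence "norm (c * w) = 1" by (metis add.commute add_eq_0_iff norm_minus_cancel norm_one)
    moreover have "norm (c * w) < 1"
    proof -
      have "norm (c * w) \<le> norm c * r" using that by (simp add: norm_mult mult_left_mono)
      also have "\<dots> < 1" by (simp add: r_def field_simps add_pos_nonneg)
      finally show ?thesis .
    qed
    ultimately show False by simp
  qed
  have np: "1 + w \<notin> \<real>\<^sub>\<le>\<^sub>0" if "norm w < r" for w :: complex
    using that r abs_Re_le_cmod[of w] by (auto simp: complex_nonpos_Reals_iff)
  have "G holomorphic_on ball 0 r"
    unfolding G_def by (intro holomorphic_intros) (use nz np in auto)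
  \<comment> \<open>The three factors contribute c - d, d and -c, which cancel. The exponent in
    \<open>Gamma_quot\<close> is chosen for this.\<close>
  moreover have "(G has_field_derivative 0) (at 0)"
    unfolding G_def by (auto intro!: derivative_eq_intros simp: field_simps)
  ultimately obtain C \<delta> where C: "0 < \<delta>" "0 \<le> C"
    "\<And>w. norm w \<le> \<delta> \<Longrightarrow> norm (G w - G 0) \<le> C * (norm w)^2"
    using second_order_bound[OF r(1)] by metis
  have G0: "G 0 = 1" by (simp add: G_def)
  \<comment> \<open>The factor 2 pays for the shift: |s + k| >= |s| / 2 >= R / 2, which exceeds |c|,
    |d| and 1 / \<delta>.\<close>
  define R where "R = 2 * (1 + norm c + norm d + 1 / \<delta>)"
  have R: "R \<ge> 2" "norm c < R / 2" "norm d < R / 2" "1 / \<delta> < R / 2" using C(1) by (auto simp: R_def add_nonneg_pos add_pos_nonneg)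
  \<comment> \<open>Bounds the infinite product of the factors 1 + 2C / (1 + k^2), by 1 + y <= exp
    y.\<close>
  define K where "K = exp (C * (\<Sum>k. 2 / (1 + (real k)^2)))"
  have key: "norm (Gamma_quot c d s) \<le> K" if s: "R \<le> norm s" "- norm s / 2 \<le> Re s" for s
  proof -
    have sq: "((norm s)^2 + (real k)^2) / 2 \<le> (norm (s + of_nat k))^2" for k
      by (rule norm_add_of_nat_sector[OF s(2)])
    have ge: "R / 2 \<le> norm (s + of_nat k)" for k
      using norm_add_of_nat_sector'[OF s(2), of k] s(1) by simp
    have ni: "e + (s + of_nat k) \<noteq> 0" if "norm e < R / 2" for k e
    proof
      assume "e + (s + of_nat k) = 0"
      hence "norm (s + of_nat k) = norm e" by (metis add_eq_0_iff norm_minus_cancel)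
      thus False using ge[of k] that by simp
    qed
    have nint: "e + s + of_nat k \<notin> \<int>\<^sub>\<le>\<^sub>0" if "norm e < R / 2" for k e
    proof
      assume "e + s + of_nat k \<in> \<int>\<^sub>\<le>\<^sub>0"
      then obtain n where "e + s + of_nat k = - of_nat n" by (elim nonpos_Ints_cases')
      hence "e + s + of_nat k + of_nat n = 0" by simp
      hence "e + (s + of_nat (k + n)) = 0" by (simp add: add.assoc)
      thus False using ni that by blast
    qed
    have npr: "s + of_nat k \<notin> \<real>\<^sub>\<le>\<^sub>0" for k
    proof
      assume a: "s + of_nat k \<in> \<real>\<^sub>\<le>\<^sub>0"
      hence "Im s = 0" "Re s \<le> 0" by (auto simp: complex_nonpos_Reals_iff)
      hence "norm s = - Re s" by (simp add: cmod_def)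
      thus False using s R(1) by simp
    qed
    have step: "norm (Gamma_quot c d (s + of_nat k)) \<le>
        norm (Gamma_quot c d (s + of_nat (Suc k))) * exp (C * (2 / (1 + (real k)^2)))" for k
    proof -
      let ?w = "1 / (s + of_nat k)"
      have "norm ?w \<le> \<delta>"
      proof -
        have "1 / \<delta> \<le> norm (s + of_nat k)" using ge[of k] R by linarith
        hence "1 / norm (s + of_nat k) \<le> 1 / (1 / \<delta>)"
          using C(1) by (intro divide_left_mono mult_pos_pos) (auto intro: less_le_trans[of 0 "1/\<delta>"])
        thus ?thesis by (simp add: norm_divide)
      qed
      from C(3)[OF this] have "norm (G ?w) \<le> 1 + C * (norm ?w)^2"
        using G0 norm_triangle_ineq2[of "G ?w" 1] by simp
      also have "(norm ?w)^2 \<le> 2 / (1 + (real k)^2)"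
      proof -
        have "1 \<le> norm s" using s R by linarith
        hence "1 \<le> (norm s)^2" by simp
        hence "(1 + (real k)^2) / 2 \<le> (norm (s + of_nat k))^2" using sq[of k] by simp
        hence "1 / (norm (s + of_nat k))^2 \<le> 1 / ((1 + (real k)^2) / 2)"
          using ge[of k] R(1)
          by (intro divide_left_mono mult_pos_pos zero_less_power) (auto simp: add_pos_nonneg)
        thus ?thesis by (simp add: norm_divide power_divide)
      qed
      also have "1 + C * (2 / (1 + (real k)^2)) \<le> exp (C * (2 / (1 + (real k)^2)))"
        by (rule exp_ge_add_one_self)
      finally have G: "norm (G ?w) \<le> exp (C * (2 / (1 + (real k)^2)))"
        using C(2) by (simp add: mult_left_mono)
      have "Gamma_quot c d (s + of_nat k) = Gamma_quot c d (s + of_nat (Suc k)) * G ?w"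
        using Gamma_quot_step[of "s + of_nat k" c d] npr[of k] nint[of c k] R
        by (simp add: G_def add_ac)
      thus ?thesis using G by (simp add: norm_mult mult_left_mono)
    qed
    have ind: "norm (Gamma_quot c d s) \<le> norm (Gamma_quot c d (s + of_nat n)) * exp (C * (\<Sum>k<n. 2 / (1 + (real k)^2)))" for n
    proof (induction n)
      case (Suc n)
      have "norm (Gamma_quot c d (s + of_nat n)) * exp (C * (\<Sum>k<n. 2 / (1 + (real k)^2)))
        \<le> norm (Gamma_quot c d (s + of_nat (Suc n))) * exp (C * (2 / (1 + (real n)^2))) * exp (C * (\<Sum>k<n. 2 / (1 + (real k)^2)))"
        by (intro mult_right_mono step) auto
      also have "\<dots> = norm (Gamma_quot c d (s + of_nat (Suc n))) * exp (C * (\<Sum>k<Suc n. 2 / (1 + (real k)^2)))"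
        by (simp add: exp_add ring_distribs mult_ac)
      finally show ?case using Suc by simp
    qed simp
    have le: "norm (Gamma_quot c d s) \<le> norm (Gamma_quot c d (s + of_nat (Suc n))) * K" for n
      using ind[of "Suc n"] unfolding K_def
      by (rule order.trans) (intro mult_left_mono exp_le_cancel_iff[THEN iffD2] C sum_le_suminf summable_inverse_one_plus_square, auto simp: add_pos_nonneg)
    have "(\<lambda>n. norm (Gamma_quot c d (s + of_nat (Suc n))) * K) \<longlonglongrightarrow> norm (1::complex) * K"
      using nint[of c 0] nint[of d 0] R by (intro tendsto_intros Gamma_quot_tendsto_1) auto
    from Lim_bounded2[OF this] le show ?thesis by simp
  qed
  show ?thesis by (rule that[of R K]) (use key R in \<open>auto simp: K_def\<close>)
qed

text \<open>The modulus of exp ((c - d) Ln s) is |s|^Re(c - d) times exp (-Im(c - d) arg s). The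
  second factor is bounded, since |arg s| <= pi, and goes into the constant.\<close>

lemma Gamma_ratio_bound:
  obtains M R where "0 < R" "0 \<le> M" "norm c < R"
    "\<And>s. R \<le> norm s \<Longrightarrow> - norm s / 2 \<le> Re s \<Longrightarrow>
        norm (Gamma (c + s) / Gamma (d + s)) \<le> M * norm s powr Re (c - d)"
proof -
  obtain M R where MR: "0 < R" "0 \<le> M" "norm c < R"
    "\<And>s. R \<le> norm s \<Longrightarrow> - norm s / 2 \<le> Re s \<Longrightarrow> norm (Gamma_quot c d s) \<le> M"
    by (rule Gamma_quot_bounded[of c d]) blast
  show ?thesis
  proof (rule that[of R "M * exp (\<bar>Im (c - d)\<bar> * pi)"])
    fix s assume s: "R \<le> norm s" "- norm s / 2 \<le> Re s"
    have s0: "s \<noteq> 0" using s MR(1) by auto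
    \<comment> \<open>Also correct at a pole of Gamma (d + s): there \<open>Gamma\<close> and
      \<open>rGamma\<close> are both 0, and so are both sides.\<close>
    have "Gamma (c + s) / Gamma (d + s) = Gamma_quot c d s * exp ((c - d) * Ln s)"
      by (simp add: Gamma_quot_def rGamma_inverse_Gamma field_simps flip: exp_add)
    hence "norm (Gamma (c + s) / Gamma (d + s)) = norm (Gamma_quot c d s) * exp (Re ((c - d) * Ln s))"
      by (simp add: norm_mult)
    also have "\<dots> \<le> M * exp (Re (c - d) * ln (norm s) + \<bar>Im (c - d)\<bar> * pi)"
    proof (intro mult_mono MR s)
      have "\<bar>Im (Ln s)\<bar> \<le> pi" using Im_Ln_le_pi[OF s0] mpi_less_Im_Ln[OF s0] by simp
      hence "\<bar>Im (c - d) * Im (Ln s)\<bar> \<le> \<bar>Im (c - d)\<bar> * pi"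
        unfolding abs_mult by (intro mult_left_mono) auto
      thus "exp (Re ((c - d) * Ln s)) \<le> exp (Re (c - d) * ln (norm s) + \<bar>Im (c - d)\<bar> * pi)"
        using s0 by (simp add: Re_Ln algebra_simps)
    qed auto
    also have "\<dots> = M * exp (\<bar>Im (c - d)\<bar> * pi) * norm s powr Re (c - d)"
      using s0 by (simp add: powr_def exp_add)
    finally show "norm (Gamma (c + s) / Gamma (d + s)) \<le> M * exp (\<bar>Im (c - d)\<bar> * pi) * norm s powr Re (c - d)" .
  qed (use MR in auto)
qed

text \<open>The lists are paired entry by entry. The bound |c| < R is exported because it keeps the
  poles of the numerator away when holomorphy in the sector is shown.\<close>

lemma Gamma_prod_ratio_bound:
  assumes "length C = length D"
  obtains M R where "0 < R" "0 \<le> M" "\<And>c. c \<in> set C \<Longrightarrow> norm c < R"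
    "\<And>s. R \<le> norm s \<Longrightarrow> - norm s / 2 \<le> Re s \<Longrightarrow>
       norm ((\<Prod>c\<leftarrow>C. Gamma (c + s)) / (\<Prod>d\<leftarrow>D. Gamma (d + s)))
         \<le> M * norm s powr Re (sum_list C - sum_list D)"
proof -
  have "\<exists>M R. 0 < R \<and> 0 \<le> M \<and> (\<forall>c\<in>set C. norm c < R) \<and>
    (\<forall>s. R \<le> norm s \<longrightarrow> - norm s / 2 \<le> Re s \<longrightarrow>
       norm ((\<Prod>c\<leftarrow>C. Gamma (c + s)) / (\<Prod>d\<leftarrow>D. Gamma (d + s)))
         \<le> M * norm s powr Re (sum_list C - sum_list D))"
    using assms
  proof (induction C D rule: list_induct2)
    case Nil
    show ?case by (intro exI[of _ 1]) auto
  next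
    case (Cons c C d D)
    then obtain M R where MR: "0 < R" "0 \<le> M" "\<And>c. c \<in> set C \<Longrightarrow> norm c < R"
      "\<And>s. R \<le> norm s \<Longrightarrow> - norm s / 2 \<le> Re s \<Longrightarrow>
       norm ((\<Prod>c\<leftarrow>C. Gamma (c + s)) / (\<Prod>d\<leftarrow>D. Gamma (d + s)))
         \<le> M * norm s powr Re (sum_list C - sum_list D)" by blast
    obtain M' R' where MR': "0 < R'" "0 \<le> M'" "norm c < R'"
      "\<And>s. R' \<le> norm s \<Longrightarrow> - norm s / 2 \<le> Re s \<Longrightarrow>
        norm (Gamma (c + s) / Gamma (d + s)) \<le> M' * norm s powr Re (c - d)"
      by (rule Gamma_ratio_bound[of c d]) blast
    show ?case
    proof (rule exI[of _ "M' * M"], rule exI[of _ "max R R'"], intro conjI allI impI)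
      fix s assume s: "max R R' \<le> norm s" "- norm s / 2 \<le> Re s"
      have "norm ((\<Prod>c\<leftarrow>c#C. Gamma (c + s)) / (\<Prod>d\<leftarrow>d#D. Gamma (d + s))) =
        norm (Gamma (c + s) / Gamma (d + s)) * norm ((\<Prod>c\<leftarrow>C. Gamma (c + s)) / (\<Prod>d\<leftarrow>D. Gamma (d + s)))"
        by (simp flip: norm_mult)
      also have "\<dots> \<le> (M' * norm s powr Re (c - d)) * (M * norm s powr Re (sum_list C - sum_list D))"
        using s MR MR' by (intro mult_mono) auto
      also have "\<dots> = M' * M * norm s powr Re (sum_list (c#C) - sum_list (d#D))"
        by (simp add: algebra_simps flip: powr_add)
      finally show "norm ((\<Prod>c\<leftarrow>c#C. Gamma (c + s)) / (\<Prod>d\<leftarrow>d#D. Gamma (d + s)))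
        \<le> M' * M * norm s powr Re (sum_list (c#C) - sum_list (d#D))" .
    qed (use MR MR' in \<open>auto simp: less_max_iff_disj\<close>)
  qed
  then obtain M R where MR: "0 < R" "0 \<le> M" "\<forall>c\<in>set C. norm c < R"
    "\<forall>s. R \<le> norm s \<longrightarrow> - norm s / 2 \<le> Re s \<longrightarrow>
       norm ((\<Prod>c\<leftarrow>C. Gamma (c + s)) / (\<Prod>d\<leftarrow>D. Gamma (d + s)))
         \<le> M * norm s powr Re (sum_list C - sum_list D)"
    by (elim exE conjE)
  show ?thesis by (rule that[OF MR(1,2) MR(3,4)[rule_format]])
qed

text \<open>
  The estimate is assumed in a sector larger than the half-plane, so that Cauchy's inequality applies
  on discs of radius \<open>\<bar>s\<bar> / 8\<close> and gains the factor \<open>1 / \<bar>s\<bar>\<close> for the derivative.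
\<close>

lemma decay_on_half_plane:
  fixes \<phi> :: "complex \<Rightarrow> complex"
  assumes holo: "\<phi> holomorphic_on {s. \<alpha> < Re s}"
    and holo': "\<phi> holomorphic_on {s. R \<le> norm s \<and> - norm s / 2 \<le> Re s}"
    and bound: "\<And>s. R \<le> norm s \<Longrightarrow> - norm s / 2 \<le> Re s \<Longrightarrow> norm (\<phi> s) \<le> M * norm s powr (- \<rho>)"
    and \<epsilon>: "0 < \<epsilon>" "\<epsilon> \<le> \<rho>" and "\<alpha> < \<gamma>" and M: "0 \<le> M"
  shows "\<exists>C\<ge>0. \<forall>s. \<gamma> \<le> Re s \<longrightarrow> norm (\<phi> s) \<le> C * (1 + norm s) powr (- \<epsilon>) \<and>
                     norm (deriv \<phi> s) \<le> C * (1 + norm s) powr (- 1 - \<epsilon>)"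
proof -
  \<comment> \<open>For |s| >= R1 and |w - s| <= |s| / 8 one has |w| >= 7|s|/8. So 2R gives |w| >=
    R, and 2 gives |w| >= 1 and |w| >= (1 + |s|) / 4. Finally 4|\<gamma>| gives Re w >= -|s|/4 -
    |s|/8 >= -|w|/2, so the disc stays in the sector.\<close>
  define R1 where "R1 = Max {2, 2 * R, 4 * \<bar>\<gamma>\<bar>}"
  have R1: "2 \<le> R1" "2 * R \<le> R1" "4 * \<bar>\<gamma>\<bar> \<le> R1" by (auto simp: R1_def)
  \<comment> \<open>The power of 4 comes from |w| >= (1 + |s|) / 4. The 16 below comes from 8 / |s|
    <= 16 / (1 + |s|), that is from Cauchy's inequality with radius |s| / 8.\<close>
  define M1 where "M1 = M * 4 powr \<epsilon>"
  have M1: "0 \<le> M1" using M by (simp add: M1_def)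
  have op: "open {s. \<alpha> < Re s}" by (simp add: open_halfspace_Re_gt)
  have far: "norm (\<phi> s) \<le> 16 * M1 * (1 + norm s) powr (- \<epsilon>) \<and>
             norm (deriv \<phi> s) \<le> 16 * M1 * (1 + norm s) powr (- 1 - \<epsilon>)"
    if s: "\<gamma> \<le> Re s" "R1 \<le> norm s" for s
  proof -
    have w: "R \<le> norm w \<and> - norm w / 2 \<le> Re w \<and> norm (\<phi> w) \<le> M1 * (1 + norm s) powr (- \<epsilon>)"
      if "norm (s - w) \<le> norm s / 8" for w
    proof -
      have n: "7/8 * norm s \<le> norm w" using that norm_triangle_ineq2[of s w] by linarith
      have a: "R \<le> norm w" using n s R1 by linarith
      have "Re s - Re w \<le> norm s / 8" using complex_Re_le_cmod[of "s - w"] that by simp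
      hence b: "- norm w / 2 \<le> Re w" using n s R1 by linarith
      have n': "(1 + norm s) / 4 \<le> norm w" using n s(2) R1(1) by (simp add: field_simps)
      have "norm (\<phi> w) \<le> M * norm w powr (- \<rho>)" using bound a b by blast
      also have "\<dots> \<le> M * norm w powr (- \<epsilon>)"
        using n s R1 \<epsilon> M by (intro mult_left_mono powr_mono) linarith+
      also have "\<dots> \<le> M * ((1 + norm s) / 4) powr (- \<epsilon>)"
        using n' \<epsilon> M by (intro mult_left_mono powr_mono2') (auto simp: add_pos_nonneg)
      also have "\<dots> = M1 * (1 + norm s) powr (- \<epsilon>)"
        by (simp add: M1_def powr_divide powr_minus field_simps)
      finally show ?thesis using a b by blast
    qed
    have "norm ((deriv ^^ 1) \<phi> s) \<le> (fact 1) * (M1 * (1 + norm s) powr (- \<epsilon>)) / (norm s / 8) ^ 1"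
    proof (rule Cauchy_inequality)
      have "\<phi> holomorphic_on cball s (norm s / 8)"
        by (rule holomorphic_on_subset[OF holo']) (use w in \<open>auto simp: dist_norm\<close>)
      thus "\<phi> holomorphic_on ball s (norm s / 8)" "continuous_on (cball s (norm s / 8)) \<phi>"
        by (auto intro: holomorphic_on_imp_continuous_on holomorphic_on_subset)
    qed (use w s R1 in auto)
    also have "\<dots> = 8 / norm s * (M1 * (1 + norm s) powr (- \<epsilon>))" by simp
    also have "\<dots> \<le> 16 / (1 + norm s) * (M1 * (1 + norm s) powr (- \<epsilon>))"
      using s(2) R1(1) M1 by (intro mult_right_mono) (auto simp: divide_simps)
    also have "\<dots> = 16 * M1 * (1 + norm s) powr (- 1 - \<epsilon>)"
      using add_pos_nonneg[OF zero_less_one norm_ge_zero[of s]] by (simp add: powr_diff powr_minus divide_simps)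
    moreover have "norm (\<phi> s) \<le> 16 * (M1 * (1 + norm s) powr (- \<epsilon>))"
    proof -
      have "norm (\<phi> s) \<le> M1 * (1 + norm s) powr (- \<epsilon>)" using w[of s] by simp
      also have "\<dots> \<le> 16 * (M1 * (1 + norm s) powr (- \<epsilon>))" using M1 by simp
      finally show ?thesis .
    qed
    ultimately show ?thesis by simp
  qed
  define K where "K = {s. \<gamma> \<le> Re s} \<inter> cball 0 R1"
  have K: "compact K" "K \<subseteq> {s. \<alpha> < Re s}"
    using \<open>\<alpha> < \<gamma>\<close> unfolding K_def by (auto intro!: closed_Int_compact closed_halfspace_Re_ge)
  have "compact (\<phi> ` K)" "compact (deriv \<phi> ` K)"
    using holo holomorphic_deriv[OF holo op] K
    by (auto intro!: compact_continuous_image intro: holomorphic_on_imp_continuous_on holomorphic_on_subset)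
  then obtain B0 B1 where B: "\<And>s. s \<in> K \<Longrightarrow> norm (\<phi> s) \<le> B0" "\<And>s. s \<in> K \<Longrightarrow> norm (deriv \<phi> s) \<le> B1"
    by (metis (no_types, lifting) bounded_iff compact_imp_bounded image_eqI)
  define B where "B = \<bar>B0\<bar> + \<bar>B1\<bar>"
  \<comment> \<open>On the compact remainder mere boundedness suffices: (1 + R1)^(1 + \<epsilon>)
    makes the decaying powers at least 1 there.\<close>
  have near: "norm (\<phi> s) \<le> B * (1 + R1) powr (1 + \<epsilon>) * (1 + norm s) powr (- \<epsilon>) \<and>
              norm (deriv \<phi> s) \<le> B * (1 + R1) powr (1 + \<epsilon>) * (1 + norm s) powr (- 1 - \<epsilon>)"
    if s: "\<gamma> \<le> Re s" "norm s \<le> R1" for s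
  proof -
    have sK: "s \<in> K" using s by (auto simp: K_def)
    have "1 = (1 + norm s) powr (1 + \<epsilon>) * (1 + norm s) powr (- 1 - \<epsilon>)"
      by (simp flip: powr_add add: add_pos_nonneg) (metis add_pos_nonneg norm_ge_zero order_less_irrefl zero_less_one)
    also have "\<dots> \<le> (1 + R1) powr (1 + \<epsilon>) * (1 + norm s) powr (- 1 - \<epsilon>)"
      using s \<epsilon> by (intro mult_right_mono powr_mono2) auto
    finally have 1: "1 \<le> (1 + R1) powr (1 + \<epsilon>) * (1 + norm s) powr (- 1 - \<epsilon>)" .
    also have "\<dots> \<le> (1 + R1) powr (1 + \<epsilon>) * (1 + norm s) powr (- \<epsilon>)"
      by (intro mult_left_mono powr_mono) auto
    finally have 2: "1 \<le> (1 + R1) powr (1 + \<epsilon>) * (1 + norm s) powr (- \<epsilon>)" .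
    have "norm (\<phi> s) \<le> B" "norm (deriv \<phi> s) \<le> B" "0 \<le> B"
      using B[OF sK] unfolding B_def by linarith+
    thus ?thesis using mult_left_mono[OF 1, of B] mult_left_mono[OF 2, of B] by (auto simp: mult.assoc)
  qed
  define C where "C = 16 * M1 + B * (1 + R1) powr (1 + \<epsilon>)"
  have "0 \<le> B" by (simp add: B_def)
  show ?thesis
  proof (intro exI[of _ C] conjI allI impI)
    show "0 \<le> C" using M1 \<open>0 \<le> B\<close> by (simp add: C_def)
    fix s assume s: "\<gamma> \<le> Re s"
    have C: "16 * M1 * x \<le> C * x" "B * (1 + R1) powr (1 + \<epsilon>) * x \<le> C * x" if "0 \<le> x" for x
      using that M1 \<open>0 \<le> B\<close> by (auto simp: C_def intro!: mult_right_mono)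
    show "norm (\<phi> s) \<le> C * (1 + norm s) powr (- \<epsilon>)"
      using far[OF s] near[OF s] C[of "(1 + norm s) powr (- \<epsilon>)"] by fastforce
    show "norm (deriv \<phi> s) \<le> C * (1 + norm s) powr (- 1 - \<epsilon>)"
      using far[OF s] near[OF s] C[of "(1 + norm s) powr (- 1 - \<epsilon>)"] by fastforce
  qed
qed

section \<open>Oscillatory integrals\<close>

lemma has_integral_one_plus_powr:
  fixes a b p :: real
  assumes "0 \<le> a" "a \<le> b" "p \<noteq> -1"
  shows "((\<lambda>t. (1 + t) powr p) has_integral ((1 + b) powr (p + 1) - (1 + a) powr (p + 1)) / (p + 1)) {a..b}"
proof -
  have "((\<lambda>t. (1 + t) powr p) has_integral
      (1 + b) powr (p + 1) / (p + 1) - (1 + a) powr (p + 1) / (p + 1)) {a..b}"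
    using assms
    by (intro fundamental_theorem_of_calculus)
      (auto intro!: derivative_eq_intros simp flip: has_real_derivative_iff_has_vector_derivative simp: add_eq_0_iff)
  thus ?thesis by (simp add: diff_divide_distrib)
qed

lemma tendsto_one_plus_powr_at_top:
  fixes \<epsilon> :: real
  assumes "0 < \<epsilon>"
  shows "((\<lambda>R. K * (1 + R) powr (- \<epsilon>)) \<longlongrightarrow> 0) at_top"
proof -
  have "((\<lambda>a::real. (1 + a) powr (- \<epsilon>)) \<longlongrightarrow> 0) at_top"
    using assms by (intro tendsto_neg_powr filterlim_tendsto_add_at_top[OF tendsto_const filterlim_ident]) auto
  from tendsto_mult[OF tendsto_const this] show ?thesis by simp
qed

text \<open>Models one half of a vertical line, f t being the kernel at \<gamma> + it or \<gamma> -
  it. The frequency v of the exponential will be -ln x or ln x. With \<epsilon> < 1 the trivial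
  estimate of the integral over [0, b] grows like (1 + b)^(1 - \<epsilon>).\<close>

locale oscillatory =
  fixes f f' :: "real \<Rightarrow> complex" and C \<epsilon> :: real
  assumes \<epsilon>: "0 < \<epsilon>" "\<epsilon> < 1"
    and deriv: "\<And>t. 0 \<le> t \<Longrightarrow> (f has_vector_derivative f' t) (at t)"
    and cont: "continuous_on {0..} f'"
    and bound: "\<And>t. 0 \<le> t \<Longrightarrow> norm (f t) \<le> C * (1 + t) powr (- \<epsilon>)"
    and bound': "\<And>t. 0 \<le> t \<Longrightarrow> norm (f' t) \<le> C * (1 + t) powr (- 1 - \<epsilon>)"
begin

definition osc_integral :: "real \<Rightarrow> real \<Rightarrow> real \<Rightarrow> complex" where
  "osc_integral v a b = integral {a..b} (\<lambda>t. f t * exp (\<i> * of_real (v * t)))"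

lemma C_nonneg: "0 \<le> C"
  using order.trans[OF norm_ge_zero bound[of 0]] by simp

lemma cont_f: "continuous_on {0..} f"
  using deriv by (auto intro!: continuous_at_imp_continuous_on dest: has_vector_derivative_continuous)

lemma integrable: "0 \<le> a \<Longrightarrow> (\<lambda>t. f t * exp (\<i> * of_real (v * t))) integrable_on {a..b}"
  by (intro integrable_continuous_interval continuous_intros continuous_on_subset[OF cont_f]) auto

lemma osc_integral_combine:
  "0 \<le> a \<Longrightarrow> a \<le> b \<Longrightarrow> osc_integral v 0 b = osc_integral v 0 a + osc_integral v a b"
  unfolding osc_integral_def by (rule Henstock_Kurzweil_Integration.integral_combine[symmetric]) (auto intro: integrable simp del: of_real_mult)

text \<open>Integration by parts divides by iv. The two boundary terms give the 2 of the constant,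
  the integral of the derivative gives 1 / \<epsilon>.\<close>

lemma osc_integral_tail:
  assumes v: "v \<noteq> 0" and ab: "0 \<le> a" "a \<le> b"
  shows "norm (osc_integral v a b) \<le> C * (2 + 1 / \<epsilon>) * (1 + a) powr (- \<epsilon>) / \<bar>v\<bar>"
proof -
  define g where "g = (\<lambda>t. f t * exp (\<i> * of_real (v * t)) / (\<i> * of_real v))"
  define k where "k = (\<lambda>t. f' t * exp (\<i> * of_real (v * t)) / (\<i> * of_real v))"
  have "((\<lambda>t. f t * exp (\<i> * of_real (v * t)) + k t) has_integral g b - g a) {a..b}"
  proof (rule fundamental_theorem_of_calculus[OF ab(2)])
    fix t assume t: "t \<in> {a..b}"
    have "((\<lambda>t. exp (\<i> * of_real (v * t))) has_vector_derivative \<i> * of_real v * exp (\<i> * of_real (v * t))) (at t)"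
    proof -
      have "((\<lambda>z. exp (\<i> * (of_real v * z))) has_field_derivative \<i> * of_real v * exp (\<i> * (of_real v * of_real t)))
          (at (of_real t))"
        by (auto intro!: derivative_eq_intros)
      from has_vector_derivative_real_field[OF this] show ?thesis by simp
    qed
    from has_vector_derivative_mult[OF deriv this] t ab
    have "((\<lambda>t. f t * exp (\<i> * of_real (v * t))) has_vector_derivative
        f t * (\<i> * of_real v * exp (\<i> * of_real (v * t))) + f' t * exp (\<i> * of_real (v * t))) (at t)" by simp
    from has_vector_derivative_divide[OF this, of "\<i> * of_real v"]
    have "(g has_vector_derivative f t * exp (\<i> * of_real (v * t)) + k t) (at t)"
      using v by (simp add: g_def k_def add_divide_distrib)
    thus "(g has_vector_derivative f t * exp (\<i> * of_real (v * t)) + k t) (at t within {a..b})"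
      by (rule has_vector_derivative_at_within)
  qed
  moreover have ki: "k integrable_on {a..b}"
    unfolding k_def using v ab
    by (intro integrable_continuous_interval continuous_intros continuous_on_subset[OF cont]) auto
  ultimately have "osc_integral v a b = g b - g a - integral {a..b} k"
    unfolding osc_integral_def
    using has_integral_diff[OF _ integrable_integral[OF ki]] by (intro integral_unique) fastforce
  also have "norm \<dots> \<le> norm (g b) + norm (g a) + norm (integral {a..b} k)"
    by (intro order.trans[OF norm_triangle_ineq4] add_mono norm_triangle_ineq4 order_refl)
  also have "norm (integral {a..b} k) \<le> integral {a..b} (\<lambda>t. C / \<bar>v\<bar> * (1 + t) powr (- 1 - \<epsilon>))"
  proof (rule integral_norm_bound_integral[OF ki])
    show "(\<lambda>t. C / \<bar>v\<bar> * (1 + t) powr (- 1 - \<epsilon>)) integrable_on {a..b}"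
      using has_integral_one_plus_powr[OF ab, of "-1-\<epsilon>"] \<epsilon>
      by (intro integrable_on_mult_right) auto
    show "norm (k t) \<le> C / \<bar>v\<bar> * (1 + t) powr (- 1 - \<epsilon>)" if "t \<in> {a..b}" for t
      using bound'[of t] that ab v by (simp add: k_def norm_mult norm_divide divide_right_mono)
  qed
  also have "\<dots> = C / \<bar>v\<bar> * (((1 + b) powr (- \<epsilon>) - (1 + a) powr (- \<epsilon>)) / (- \<epsilon>))"
    using has_integral_mult_right[OF has_integral_one_plus_powr[OF ab, of "-1-\<epsilon>"], of "C / \<bar>v\<bar>"] \<epsilon>
    by (intro integral_unique) simp
  also have "\<dots> \<le> C / \<bar>v\<bar> * ((1 + a) powr (- \<epsilon>) / \<epsilon>)"
  proof (intro mult_left_mono)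
    show "((1 + b) powr (- \<epsilon>) - (1 + a) powr (- \<epsilon>)) / (- \<epsilon>) \<le> (1 + a) powr (- \<epsilon>) / \<epsilon>"
      using \<epsilon> by (simp add: field_simps)
  qed (use C_nonneg in auto)
  also have "norm (g b) \<le> C / \<bar>v\<bar> * (1 + a) powr (- \<epsilon>)"
  proof -
    have "norm (g b) = norm (f b) / \<bar>v\<bar>" by (simp add: g_def norm_mult norm_divide)
    also have "\<dots> \<le> C * (1 + b) powr (- \<epsilon>) / \<bar>v\<bar>" using bound[of b] ab by (intro divide_right_mono) auto
    also have "\<dots> \<le> C * (1 + a) powr (- \<epsilon>) / \<bar>v\<bar>"
      using ab \<epsilon> C_nonneg by (intro divide_right_mono mult_left_mono powr_mono2') auto
    finally show ?thesis by simp
  qed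
  also have "norm (g a) \<le> C / \<bar>v\<bar> * (1 + a) powr (- \<epsilon>)"
    using bound[of a] ab by (simp add: g_def norm_mult norm_divide divide_right_mono)
  finally show ?thesis by (simp add: algebra_simps add_divide_distrib)
qed

definition osc_const :: real where
  "osc_const = C * (1 / (1 - \<epsilon>) + (2 + 1 / \<epsilon>))"

lemma osc_integral_short:
  assumes "0 \<le> b"
  shows "norm (osc_integral v 0 b) \<le> C * (1 / (1 - \<epsilon>)) * (1 + b) powr (1 - \<epsilon>)"
proof -
  have "norm (osc_integral v 0 b) \<le> integral {0..b} (\<lambda>t. C * (1 + t) powr (- \<epsilon>))"
    unfolding osc_integral_def
  proof (rule integral_norm_bound_integral)
    show "(\<lambda>t. C * (1 + t) powr (- \<epsilon>)) integrable_on {0..b}"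
      using has_integral_mult_right[OF has_integral_one_plus_powr[of 0 b "-\<epsilon>"]] assms \<epsilon> by auto
    show "norm (f t * exp (\<i> * of_real (v * t))) \<le> C * (1 + t) powr (- \<epsilon>)" if "t \<in> {0..b}" for t
      using bound[of t] that by (simp add: norm_mult)
  qed (rule integrable, simp)
  also have "\<dots> = C * (((1 + b) powr (1 - \<epsilon>) - 1) / (1 - \<epsilon>))"
    using has_integral_mult_right[OF has_integral_one_plus_powr[of 0 b "-\<epsilon>"], of C] assms \<epsilon>
    by (intro integral_unique) simp
  also have "\<dots> \<le> C * ((1 + b) powr (1 - \<epsilon>) / (1 - \<epsilon>))"
    using \<epsilon> C_nonneg by (intro mult_left_mono divide_right_mono) auto
  finally show ?thesis by simp
qed

text \<open>The integral is split at \<open>1 / \<bar>v\<bar>\<close>: the trivial estimate is used before, the oscillation after.\<close>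

lemma osc_integral_bound:
  assumes v: "v \<noteq> 0" and "0 \<le> b"
  shows "norm (osc_integral v 0 b) \<le> osc_const * (1 + 1 / \<bar>v\<bar>) powr (1 - \<epsilon>)"
proof -
  let ?P = "(1 + 1 / \<bar>v\<bar>) powr (1 - \<epsilon>)"
  show ?thesis
  proof (cases "b \<le> 1 / \<bar>v\<bar>")
    case True
    have "norm (osc_integral v 0 b) \<le> C * (1 / (1 - \<epsilon>)) * (1 + b) powr (1 - \<epsilon>)"
      by (rule osc_integral_short) fact
    also have "\<dots> \<le> osc_const * ?P"
      unfolding osc_const_def using True assms \<epsilon> C_nonneg
      by (intro mult_mono powr_mono2 mult_left_mono) auto
    finally show ?thesis .
  next
    case False
    let ?a = "1 / \<bar>v\<bar>"
    have "norm (osc_integral v 0 b) \<le> norm (osc_integral v 0 ?a) + norm (osc_integral v ?a b)"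
      using osc_integral_combine[of ?a b v] False norm_triangle_ineq by simp
    also have "norm (osc_integral v 0 ?a) \<le> C * (1 / (1 - \<epsilon>)) * ?P"
      by (rule osc_integral_short) simp
    also have "norm (osc_integral v ?a b) \<le> C * (2 + 1 / \<epsilon>) * (1 + ?a) powr (- \<epsilon>) / \<bar>v\<bar>"
      using False v by (intro osc_integral_tail) auto
    also have "\<dots> = C * (2 + 1 / \<epsilon>) * ((1 + ?a) powr (- \<epsilon>) * ?a)" by simp
    also have "\<dots> \<le> C * (2 + 1 / \<epsilon>) * ((1 + ?a) powr (- \<epsilon>) * (1 + ?a) powr 1)"
      using C_nonneg \<epsilon> v by (intro mult_left_mono) (auto simp: add_pos_nonneg)
    also have "\<dots> = C * (2 + 1 / \<epsilon>) * ?P"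
      by (simp only: powr_add[symmetric]) simp
    finally show ?thesis by (simp add: osc_const_def algebra_simps)
  qed
qed

lemma osc_integral_converges:
  assumes v: "v \<noteq> 0"
  obtains L where "(osc_integral v 0 \<longlongrightarrow> L) at_top"
proof -
  define K where "K = C * (2 + 1 / \<epsilon>) / \<bar>v\<bar>"
  have diff: "norm (osc_integral v 0 b - osc_integral v 0 a) \<le> K * (1 + a) powr (- \<epsilon>)"
    if "0 \<le> a" "a \<le> b" for a b
    using osc_integral_combine[OF that, of v] osc_integral_tail[OF v that] by (simp add: K_def)
  note lim = tendsto_one_plus_powr_at_top[OF \<epsilon>(1), of K]
  have "Cauchy (\<lambda>n. osc_integral v 0 (real n))"
  proof (rule metric_CauchyI)
    fix e :: real assume "0 < e"
    have "eventually (\<lambda>n. K * (1 + real n) powr (- \<epsilon>) < e / 2) sequentially"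
      using filterlim_compose[OF lim filterlim_real_sequentially] \<open>0 < e\<close>
      by (auto dest!: order_tendstoD(2)[of _ _ _ "e/2"])
    then obtain N where N: "K * (1 + real N) powr (- \<epsilon>) < e / 2"
      by (auto simp: eventually_sequentially)
    have "dist (osc_integral v 0 (real n)) (osc_integral v 0 (real N)) < e / 2" if "n \<ge> N" for n
      using diff[of "real N" "real n"] that N by (simp add: dist_norm)
    thus "\<exists>M. \<forall>m\<ge>M. \<forall>n\<ge>M. dist (osc_integral v 0 (real m)) (osc_integral v 0 (real n)) < e"
      by (intro exI[of _ N]) (metis dist_commute dist_triangle_half_r)
  qed
  then obtain L where L: "(\<lambda>n. osc_integral v 0 (real n)) \<longlonglongrightarrow> L"
    by (auto simp: Cauchy_convergent_iff convergent_def)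
  \<comment> \<open>Letting n tend to infinity in \<open>diff\<close> extends convergence along the
    integers to all real upper limits.\<close>
  have le: "norm (osc_integral v 0 a - L) \<le> K * (1 + a) powr (- \<epsilon>)" if "0 \<le> a" for a
  proof (rule tendsto_upperbound)
    show "(\<lambda>n. norm (osc_integral v 0 a - osc_integral v 0 (real n))) \<longlonglongrightarrow> norm (osc_integral v 0 a - L)"
      by (intro tendsto_intros L)
    have "eventually (\<lambda>n. a \<le> real n) sequentially"
      using filterlim_real_sequentially unfolding filterlim_at_top by blast
    thus "eventually (\<lambda>n. norm (osc_integral v 0 a - osc_integral v 0 (real n)) \<le> K * (1 + a) powr (- \<epsilon>)) sequentially"
      by eventually_elim (subst norm_minus_commute, rule diff[OF that])
  qed auto
  have "eventually (\<lambda>a. norm (osc_integral v 0 a - L) \<le> K * (1 + a) powr (- \<epsilon>)) at_top"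
    using eventually_ge_at_top[of "0::real"] by eventually_elim (rule le)
  hence "((\<lambda>a. osc_integral v 0 a - L) \<longlongrightarrow> 0) at_top"
    by (rule Lim_null_comparison[OF _ lim])
  hence "(osc_integral v 0 \<longlongrightarrow> L) at_top" by (rule Lim_null[THEN iffD2])
  thus ?thesis by (rule that)
qed

end

section \<open>Inversion of the Mellin transform on the unit interval\<close>

text \<open>The top and left sides are reversed, so that horizontal sides run to the right and
  vertical sides upwards. This is the direction used in \<open>trunc\<close> and
  \<open>horizontal_bound\<close>.\<close>

lemma contour_integral_rectpath_eq:
  assumes "continuous_on (path_image (rectpath a1 a3)) f"
  shows "contour_integral (rectpath a1 a3) f =
      contour_integral (linepath a1 (Complex (Re a3) (Im a1))) f
    + contour_integral (linepath (Complex (Re a3) (Im a1)) a3) f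
    - contour_integral (linepath (Complex (Re a1) (Im a3)) a3) f
    - contour_integral (linepath a1 (Complex (Re a1) (Im a3))) f"
proof -
  have "continuous_on (closed_segment a1 (Complex (Re a3) (Im a1))) f"
    "continuous_on (closed_segment (Complex (Re a3) (Im a1)) a3) f"
    "continuous_on (closed_segment a3 (Complex (Re a1) (Im a3))) f"
    "continuous_on (closed_segment (Complex (Re a1) (Im a3)) a1) f"
    by (rule continuous_on_subset[OF assms], force simp: rectpath_def Let_def path_image_join)+
  hence "f contour_integrable_on linepath a1 (Complex (Re a3) (Im a1))"
    "f contour_integrable_on linepath (Complex (Re a3) (Im a1)) a3"
    "f contour_integrable_on linepath a3 (Complex (Re a1) (Im a3))"
    "f contour_integrable_on linepath (Complex (Re a1) (Im a3)) a1"
    "contour_integral (linepath (Complex (Re a1) (Im a3)) a3) f = - contour_integral (linepath a3 (Complex (Re a1) (Im a3))) f"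
    "contour_integral (linepath a1 (Complex (Re a1) (Im a3))) f = - contour_integral (linepath (Complex (Re a1) (Im a3)) a1) f"
    by (auto intro!: contour_integrable_continuous_linepath contour_integral_reverse_linepath simp: closed_segment_commute)
  thus ?thesis
    by (simp add: rectpath_def Let_def)
qed

lemma powr_of_real_Complex:
  assumes "0 < x"
  shows "of_real x powr (- Complex \<gamma> t) = of_real (x powr (- \<gamma>)) * exp (\<i> * of_real (- ln x * t))"
  using assms
  by (simp add: powr_def Ln_of_real Complex_eq exp_of_real[symmetric] algebra_simps flip: exp_add)

lemma norm_of_real_powr: "0 < x \<Longrightarrow> norm (of_real x powr s :: complex) = x powr Re s"
  by (simp add: norm_powr_real_powr)

text \<open>The constant in the decay may depend on \<gamma>: in the application there can be poles
  on the boundary line Re s = \<alpha>.\<close>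

locale mellin_kernel =
  fixes \<phi> :: "complex \<Rightarrow> complex" and \<alpha> \<epsilon> :: real
  assumes holo: "\<phi> holomorphic_on {s. \<alpha> < Re s}"
    and \<epsilon>: "0 < \<epsilon>" "\<epsilon> < 1"
    and decay: "\<And>\<gamma>. \<alpha> < \<gamma> \<Longrightarrow> \<exists>C\<ge>0. \<forall>s. \<gamma> \<le> Re s \<longrightarrow>
        norm (\<phi> s) \<le> C * (1 + norm s) powr (- \<epsilon>) \<and>
        norm (deriv \<phi> s) \<le> C * (1 + norm s) powr (- 1 - \<epsilon>)"
begin

lemma open_half: "open {s. \<alpha> < Re s}"
  by (simp add: open_halfspace_Re_gt)

lemma has_deriv: "\<alpha> < Re s \<Longrightarrow> (\<phi> has_field_derivative deriv \<phi> s) (at s)"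
  using holomorphic_derivI[OF holo open_half] by simp

lemma cont_\<phi>: "continuous_on {s. \<alpha> < Re s} \<phi>"
  using holo by (rule holomorphic_on_imp_continuous_on)

lemma cont_deriv: "continuous_on {s. \<alpha> < Re s} (deriv \<phi>)"
  using holomorphic_deriv[OF holo open_half] by (rule holomorphic_on_imp_continuous_on)

text \<open>The values k = 1 and k = -1 select the upper and the lower half of the line. On both,
  |s| >= t turns decay in |s| into decay in t.\<close>

lemma oscillatory_line:
  assumes \<gamma>: "\<alpha> < \<gamma>" and k: "\<bar>k\<bar> = 1"
    and C: "\<And>s. \<gamma> \<le> Re s \<Longrightarrow> norm (\<phi> s) \<le> C * (1 + norm s) powr (- \<epsilon>) \<and>
        norm (deriv \<phi> s) \<le> C * (1 + norm s) powr (- 1 - \<epsilon>)" and C0: "0 \<le> C"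
  shows "oscillatory (\<lambda>t. \<phi> (Complex \<gamma> (k * t))) (\<lambda>t. \<i> * of_real k * deriv \<phi> (Complex \<gamma> (k * t))) C \<epsilon>"
proof
  show "0 < \<epsilon>" "\<epsilon> < 1" by (fact \<epsilon>)+
  have n: "t \<le> norm (Complex \<gamma> (k * t))" for t
    using abs_Im_le_cmod[of "Complex \<gamma> (k * t)"] k by (auto simp: abs_mult)
  fix t :: real assume t: "0 \<le> t"
  have "((\<lambda>t. \<phi> (of_real \<gamma> + \<i> * of_real k * t)) has_field_derivative deriv \<phi> (of_real \<gamma> + \<i> * of_real k * of_real t) * (\<i> * of_real k))
     (at (of_real t))"
    by (rule DERIV_chain2[OF has_deriv]) (use \<gamma> in \<open>auto intro!: derivative_eq_intros\<close>)
  from has_vector_derivative_real_field[OF this]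
  show "((\<lambda>t. \<phi> (Complex \<gamma> (k * t))) has_vector_derivative \<i> * of_real k * deriv \<phi> (Complex \<gamma> (k * t))) (at t)"
    by (simp add: Complex_eq mult_ac)
  have "norm (\<phi> (Complex \<gamma> (k * t))) \<le> C * (1 + norm (Complex \<gamma> (k * t))) powr (- \<epsilon>)"
    using C by simp
  also have "\<dots> \<le> C * (1 + t) powr (- \<epsilon>)"
    using n t \<epsilon> C0 by (intro mult_left_mono powr_mono2') auto
  finally show "norm (\<phi> (Complex \<gamma> (k * t))) \<le> C * (1 + t) powr (- \<epsilon>)" .
  have "norm (\<i> * of_real k * deriv \<phi> (Complex \<gamma> (k * t))) \<le> C * (1 + norm (Complex \<gamma> (k * t))) powr (- 1 - \<epsilon>)"
    using C k by (simp add: norm_mult)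
  also have "\<dots> \<le> C * (1 + t) powr (- 1 - \<epsilon>)"
    using n t \<epsilon> C0 by (intro mult_left_mono powr_mono2') auto
  finally show "norm (\<i> * of_real k * deriv \<phi> (Complex \<gamma> (k * t))) \<le> C * (1 + t) powr (- 1 - \<epsilon>)" .
next
  show "continuous_on {0..} (\<lambda>t. \<i> * of_real k * deriv \<phi> (Complex \<gamma> (k * t)))"
    by (intro continuous_intros continuous_on_compose2[OF cont_deriv]) (use \<gamma> in \<open>auto simp: Complex_eq intro!: continuous_intros\<close>)
qed

text \<open>Has the shape of \<open>meijer_G_trunc\<close> for a general kernel, so that the two
  agree by unfolding.\<close>

definition trunc :: "real \<Rightarrow> real \<Rightarrow> real \<Rightarrow> complex" where
  "trunc x \<gamma> R = 1 / (2 * of_real pi * \<i>) *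
     contour_integral (linepath (Complex \<gamma> (- R)) (Complex \<gamma> R)) (\<lambda>s. \<phi> s * of_real x powr (- s))"

lemma trunc_eq_integral:
  assumes "0 < R"
  shows "trunc x \<gamma> R = 1 / (2 * of_real pi) *
     integral {-R..R} (\<lambda>t. \<phi> (Complex \<gamma> t) * of_real x powr (- Complex \<gamma> t))"
  unfolding trunc_def using assms
  by (subst contour_integral_linepath_same_Re[where c = \<gamma> and a = "-R" and b = R]) auto

abbreviation line_integral :: "real \<Rightarrow> real \<Rightarrow> real \<Rightarrow> real \<Rightarrow> complex" where
  "line_integral \<gamma> k v R \<equiv> oscillatory.osc_integral (\<lambda>t. \<phi> (Complex \<gamma> (k * t))) v 0 R"

lemma trunc_eq_line_integrals:
  assumes \<gamma>: "\<alpha> < \<gamma>" and x: "0 < x" and R: "0 < R"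
  shows "trunc x \<gamma> R = of_real (x powr (- \<gamma>) / (2 * pi)) *
     (line_integral \<gamma> 1 (- ln x) R + line_integral \<gamma> (- 1) (ln x) R)"
proof -
  obtain C where C: "0 \<le> C" "\<And>s. \<gamma> \<le> Re s \<Longrightarrow> norm (\<phi> s) \<le> C * (1 + norm s) powr (- \<epsilon>) \<and>
        norm (deriv \<phi> s) \<le> C * (1 + norm s) powr (- 1 - \<epsilon>)" using decay[OF \<gamma>] by blast
  interpret P: oscillatory "\<lambda>t. \<phi> (Complex \<gamma> (1 * t))" "\<lambda>t. \<i> * of_real 1 * deriv \<phi> (Complex \<gamma> (1 * t))" C \<epsilon>
    by (rule oscillatory_line) (use \<gamma> C in auto)
  interpret N: oscillatory "\<lambda>t. \<phi> (Complex \<gamma> (- 1 * t))" "\<lambda>t. \<i> * of_real (- 1) * deriv \<phi> (Complex \<gamma> (- 1 * t))" C \<epsilon>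
    by (rule oscillatory_line) (use \<gamma> C in auto)
  define h where "h = (\<lambda>t. \<phi> (Complex \<gamma> t) * exp (\<i> * of_real (- ln x * t)))"
  have "continuous_on UNIV h" unfolding h_def
    by (intro continuous_intros continuous_on_compose2[OF cont_\<phi>]) (use \<gamma> in \<open>auto simp: Complex_eq intro!: continuous_intros\<close>)
  hence hi: "h integrable_on {a..b}" for a b
    by (intro integrable_continuous_interval) (rule continuous_on_subset, auto)
  have "trunc x \<gamma> R = 1 / (2 * of_real pi) * integral {-R..R} (\<lambda>t. of_real (x powr (- \<gamma>)) * h t)"
    unfolding trunc_eq_integral[OF R] powr_of_real_Complex[OF x] h_def by (simp add: mult_ac)
  also have "\<dots> = of_real (x powr (- \<gamma>) / (2 * pi)) * integral {-R..R} h" by simp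
  also have "integral {-R..R} h = integral {-R..0} h + integral {0..R} h"
    using R by (intro Henstock_Kurzweil_Integration.integral_combine[symmetric] hi) auto
  also have "integral {-R..0} h = integral {0..R} (\<lambda>t. h (- t))"
    using Henstock_Kurzweil_Integration.integral_reflect_real[of R 0 "\<lambda>t. h (- t)"] by simp
  also have "\<dots> = line_integral \<gamma> (- 1) (ln x) R"
    using N.osc_integral_def[of "ln x" 0 R] by (simp add: h_def)
  also have "integral {0..R} h = line_integral \<gamma> 1 (- ln x) R"
    using P.osc_integral_def[of "- ln x" 0 R] by (simp add: h_def)
  finally show ?thesis by (simp add: add_ac)
qed

lemma trunc_converges:
  assumes \<gamma>: "\<alpha> < \<gamma>" and x: "0 < x" "x < 1"
  shows "\<exists>L. (trunc x \<gamma> \<longlongrightarrow> L) at_top"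
proof -
  obtain C where C: "0 \<le> C" "\<And>s. \<gamma> \<le> Re s \<Longrightarrow> norm (\<phi> s) \<le> C * (1 + norm s) powr (- \<epsilon>) \<and>
        norm (deriv \<phi> s) \<le> C * (1 + norm s) powr (- 1 - \<epsilon>)" using decay[OF \<gamma>] by blast
  interpret P: oscillatory "\<lambda>t. \<phi> (Complex \<gamma> (1 * t))" "\<lambda>t. \<i> * of_real 1 * deriv \<phi> (Complex \<gamma> (1 * t))" C \<epsilon>
    by (rule oscillatory_line) (use \<gamma> C in auto)
  interpret N: oscillatory "\<lambda>t. \<phi> (Complex \<gamma> (- 1 * t))" "\<lambda>t. \<i> * of_real (- 1) * deriv \<phi> (Complex \<gamma> (- 1 * t))" C \<epsilon>
    by (rule oscillatory_line) (use \<gamma> C in auto)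
  have "ln x < 0" using x by simp
  then obtain L1 L2 where "(P.osc_integral (- ln x) 0 \<longlongrightarrow> L1) at_top" "(N.osc_integral (ln x) 0 \<longlongrightarrow> L2) at_top"
    by (metis N.osc_integral_converges P.osc_integral_converges less_irrefl neg_equal_0_iff_equal)
  hence lim: "((\<lambda>R. of_real (x powr (- \<gamma>) / (2 * pi)) *
     (line_integral \<gamma> 1 (- ln x) R + line_integral \<gamma> (- 1) (ln x) R)) \<longlongrightarrow> of_real (x powr (- \<gamma>) / (2 * pi)) * (L1 + L2)) at_top"
    by (intro tendsto_intros)
  have "(trunc x \<gamma> \<longlongrightarrow> of_real (x powr (- \<gamma>) / (2 * pi)) * (L1 + L2)) at_top"
    by (rule Lim_transform_eventually[OF lim])
      (use eventually_gt_at_top[of "0::real"] in \<open>eventually_elim, simp add: trunc_eq_line_integrals[OF \<gamma> x(1)]\<close>)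
  thus ?thesis ..
qed

text \<open>The bound for the halves of the line involves 1 + 1/|ln x|. Since -ln x >= 1 - x, this
  is at most 2 / (1 - x). Uniformity in R makes it a majorant for dominated convergence.\<close>

lemma trunc_bound:
  assumes \<gamma>: "\<alpha> < \<gamma>"
  shows "\<exists>K\<ge>0. \<forall>x R. 0 < x \<longrightarrow> x < 1 \<longrightarrow> 0 < R \<longrightarrow>
           norm (trunc x \<gamma> R) \<le> K * (x powr (- \<gamma>) * (1 - x) powr (\<epsilon> - 1))"
proof -
  obtain C where C: "0 \<le> C" "\<And>s. \<gamma> \<le> Re s \<Longrightarrow> norm (\<phi> s) \<le> C * (1 + norm s) powr (- \<epsilon>) \<and>
        norm (deriv \<phi> s) \<le> C * (1 + norm s) powr (- 1 - \<epsilon>)" using decay[OF \<gamma>] by blast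
  interpret P: oscillatory "\<lambda>t. \<phi> (Complex \<gamma> (1 * t))" "\<lambda>t. \<i> * of_real 1 * deriv \<phi> (Complex \<gamma> (1 * t))" C \<epsilon>
    by (rule oscillatory_line) (use \<gamma> C in auto)
  interpret N: oscillatory "\<lambda>t. \<phi> (Complex \<gamma> (- 1 * t))" "\<lambda>t. \<i> * of_real (- 1) * deriv \<phi> (Complex \<gamma> (- 1 * t))" C \<epsilon>
    by (rule oscillatory_line) (use \<gamma> C in auto)
  define K where "K = P.osc_const"
  have KN: "N.osc_const = K" and KP: "P.osc_const = K"
    by (simp_all add: K_def P.osc_const_def N.osc_const_def)
  have K: "0 \<le> K" using C \<epsilon> by (simp add: K_def P.osc_const_def)
  show ?thesis
  \<comment> \<open>Each half contributes at most 2K(1 - x)^(\<epsilon> - 1), and 1 / (2 pi) <=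
    1/2.\<close>
  proof (intro exI[of _ "2 * K"] conjI allI impI)
    fix x R :: real assume x: "0 < x" "x < 1" and R: "0 < R"
    let ?u = "- ln x"
    have u: "1 - x \<le> ?u" using ln_le_minus_one[OF x(1)] by simp
    have "(1 + 1 / \<bar>?u\<bar>) powr (1 - \<epsilon>) \<le> (2 / (1 - x)) powr (1 - \<epsilon>)"
    proof (intro powr_mono2)
      have "1 / \<bar>?u\<bar> \<le> 1 / (1 - x)" using u x by (intro divide_left_mono) (simp_all add: mult_neg_pos)
      moreover have "1 \<le> 1 / (1 - x)" using x by simp
      ultimately show "1 + 1 / \<bar>?u\<bar> \<le> 2 / (1 - x)" by simp
    qed (use \<epsilon> in auto)
    also have "\<dots> = 2 powr (1 - \<epsilon>) * (1 - x) powr (\<epsilon> - 1)"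
      using x powr_minus_divide[of "1 - x" "1 - \<epsilon>"] by (simp add: powr_divide)
    also have "\<dots> \<le> 2 powr 1 * (1 - x) powr (\<epsilon> - 1)"
      using \<epsilon> by (intro mult_right_mono powr_mono) auto
    finally have le: "(1 + 1 / \<bar>?u\<bar>) powr (1 - \<epsilon>) \<le> 2 * (1 - x) powr (\<epsilon> - 1)" by simp
    have b: "norm (line_integral \<gamma> 1 (- ln x) R) \<le> K * (2 * (1 - x) powr (\<epsilon> - 1))"
      "norm (line_integral \<gamma> (- 1) (ln x) R) \<le> K * (2 * (1 - x) powr (\<epsilon> - 1))"
      using P.osc_integral_bound[of "- ln x" R] N.osc_integral_bound[of "ln x" R] x R
        mult_left_mono[OF le K] by (auto simp: KN KP)
    have "norm (trunc x \<gamma> R) = x powr (- \<gamma>) / (2 * pi) *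
        norm (line_integral \<gamma> 1 (- ln x) R + line_integral \<gamma> (- 1) (ln x) R)"
      unfolding trunc_eq_line_integrals[OF \<gamma> x(1) R] by (simp add: norm_mult norm_divide)
    also have "\<dots> \<le> x powr (- \<gamma>) / 2 *
        (K * (2 * (1 - x) powr (\<epsilon> - 1)) + K * (2 * (1 - x) powr (\<epsilon> - 1)))"
      using b pi_ge_two by (intro mult_mono norm_triangle_le add_mono divide_left_mono) auto
    finally show "norm (trunc x \<gamma> R) \<le> 2 * K * (x powr (- \<gamma>) * (1 - x) powr (\<epsilon> - 1))"
      by simp
  qed (use K in auto)
qed

text \<open>On the segment |s| >= |T|, so the decay of \<phi> is uniform. It is applied with g =
  x^(-s) to move the abscissa and with the Cauchy kernel to close the contour.\<close>

lemma horizontal_bound: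
  assumes \<gamma>: "\<alpha> < \<gamma>1" "\<gamma>1 \<le> \<gamma>2" and "0 \<le> B"
    and C: "\<And>s. \<gamma>1 \<le> Re s \<Longrightarrow> norm (\<phi> s) \<le> C * (1 + norm s) powr (- \<epsilon>)" and C0: "0 \<le> C"
    and g: "continuous_on (closed_segment (Complex \<gamma>1 T) (Complex \<gamma>2 T)) g"
    and B: "\<And>s. s \<in> closed_segment (Complex \<gamma>1 T) (Complex \<gamma>2 T) \<Longrightarrow> norm (g s) \<le> B"
  shows "norm (contour_integral (linepath (Complex \<gamma>1 T) (Complex \<gamma>2 T)) (\<lambda>s. \<phi> s * g s))
           \<le> C * (1 + \<bar>T\<bar>) powr (- \<epsilon>) * B * (\<gamma>2 - \<gamma>1)"
proof -
  have seg: "\<gamma>1 \<le> Re s \<and> \<bar>T\<bar> \<le> norm s" if "s \<in> closed_segment (Complex \<gamma>1 T) (Complex \<gamma>2 T)" for s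
    using that \<gamma> abs_Im_le_cmod[of s] by (auto simp: closed_segment_same_Im closed_segment_eq_real_ivl)
  have "norm (contour_integral (linepath (Complex \<gamma>1 T) (Complex \<gamma>2 T)) (\<lambda>s. \<phi> s * g s))
     \<le> C * (1 + \<bar>T\<bar>) powr (- \<epsilon>) * B * norm (Complex \<gamma>2 T - Complex \<gamma>1 T)"
  proof (rule contour_integral_bound_linepath)
    show "(\<lambda>s. \<phi> s * g s) contour_integrable_on linepath (Complex \<gamma>1 T) (Complex \<gamma>2 T)"
      by (intro contour_integrable_continuous_linepath continuous_on_mult g continuous_on_subset[OF cont_\<phi>])
        (use seg \<gamma> in force)
    fix s assume s: "s \<in> closed_segment (Complex \<gamma>1 T) (Complex \<gamma>2 T)"
    have "norm (\<phi> s) \<le> C * (1 + norm s) powr (- \<epsilon>)" using C seg[OF s] by simp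
    also have "\<dots> \<le> C * (1 + \<bar>T\<bar>) powr (- \<epsilon>)"
      using seg[OF s] \<epsilon> C0 by (intro mult_left_mono powr_mono2') auto
    finally show "norm (\<phi> s * g s) \<le> C * (1 + \<bar>T\<bar>) powr (- \<epsilon>) * B"
      unfolding norm_mult using B[OF s] C0 by (intro mult_mono) auto
  qed (use C0 \<open>0 \<le> B\<close> in auto)
  also have "norm (Complex \<gamma>2 T - Complex \<gamma>1 T) = \<gamma>2 - \<gamma>1"
    using \<gamma> by (simp add: complex_diff cmod_def)
  finally show ?thesis .
qed

text \<open>Cauchy's theorem on the rectangle between the two abscissas: the vertical sides differ
  by the horizontal ones, which are O(R^(-\<epsilon>)). Hence the limit does not depend on the
  abscissa.\<close>

lemma trunc_shift:
  assumes \<gamma>: "\<alpha> < \<gamma>1" "\<gamma>1 \<le> \<gamma>2" and x: "0 < x" "x < 1"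
  shows "((\<lambda>R. trunc x \<gamma>1 R - trunc x \<gamma>2 R) \<longlongrightarrow> 0) at_top"
proof -
  obtain C where C: "0 \<le> C" "\<And>s. \<gamma>1 \<le> Re s \<Longrightarrow> norm (\<phi> s) \<le> C * (1 + norm s) powr (- \<epsilon>)"
    using decay[OF \<gamma>(1)] by blast
  define g where "g = (\<lambda>s. of_real x powr (- s) :: complex)"
  have gh: "g holomorphic_on UNIV" unfolding g_def using x by (intro holomorphic_intros) auto
  \<comment> \<open>As x < 1, the modulus x^(-Re s) is largest on the right edge.\<close>
  define B where "B = x powr (- \<gamma>2)"
  have gB: "norm (g s) \<le> B" if "Re s \<le> \<gamma>2" for s
    unfolding g_def B_def norm_of_real_powr[OF x(1)] using that x by (simp add: powr_mono')
  have "norm (trunc x \<gamma>1 R - trunc x \<gamma>2 R) \<le> (C * B * (\<gamma>2 - \<gamma>1)) * (1 + R) powr (- \<epsilon>)" if R: "0 < R" for R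
  proof -
    let ?f = "\<lambda>s. \<phi> s * g s"
    let ?I = "\<lambda>a b. contour_integral (linepath a b) ?f"
    have fh: "?f holomorphic_on {s. \<alpha> < Re s}"
      by (intro holomorphic_intros holo holomorphic_on_subset[OF gh]) auto
    have sub: "path_image (rectpath (Complex \<gamma>1 (-R)) (Complex \<gamma>2 R)) \<subseteq> {s. \<alpha> < Re s}"
      using path_image_rectpath_subset_cbox[of "Complex \<gamma>1 (-R)" "Complex \<gamma>2 R"] \<gamma> R
      by (auto simp: in_cbox_complex_iff)
    have "(?f has_contour_integral 0) (rectpath (Complex \<gamma>1 (-R)) (Complex \<gamma>2 R))"
      by (rule Cauchy_theorem_convex_simple[OF fh]) (use sub in \<open>auto simp: convex_halfspace_Re_gt\<close>)
    hence "contour_integral (rectpath (Complex \<gamma>1 (-R)) (Complex \<gamma>2 R)) ?f = 0"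
      by (rule contour_integral_unique)
    moreover have "continuous_on (path_image (rectpath (Complex \<gamma>1 (-R)) (Complex \<gamma>2 R))) ?f"
      using holomorphic_on_imp_continuous_on[OF fh] sub by (rule continuous_on_subset)
    ultimately have "?I (Complex \<gamma>1 (-R)) (Complex \<gamma>1 R) - ?I (Complex \<gamma>2 (-R)) (Complex \<gamma>2 R) =
       ?I (Complex \<gamma>1 (-R)) (Complex \<gamma>2 (-R)) - ?I (Complex \<gamma>1 R) (Complex \<gamma>2 R)"
      by (subst (asm) contour_integral_rectpath_eq) (auto simp: algebra_simps)
    hence eq: "trunc x \<gamma>1 R - trunc x \<gamma>2 R = 1 / (2 * of_real pi * \<i>) *
        (?I (Complex \<gamma>1 (-R)) (Complex \<gamma>2 (-R)) - ?I (Complex \<gamma>1 R) (Complex \<gamma>2 R))"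
      unfolding trunc_def g_def by (simp flip: right_diff_distrib diff_divide_distrib)
    have h: "norm (?I (Complex \<gamma>1 T) (Complex \<gamma>2 T)) \<le> C * (1 + \<bar>T\<bar>) powr (- \<epsilon>) * B * (\<gamma>2 - \<gamma>1)" for T
    proof (rule horizontal_bound[OF \<gamma>])
      show "norm (g s) \<le> B" if "s \<in> closed_segment (Complex \<gamma>1 T) (Complex \<gamma>2 T)" for s
        using that \<gamma> by (intro gB) (auto simp: closed_segment_same_Im closed_segment_eq_real_ivl)
      show "continuous_on (closed_segment (Complex \<gamma>1 T) (Complex \<gamma>2 T)) g"
        using holomorphic_on_imp_continuous_on[OF gh] by (rule continuous_on_subset) auto
    qed (use C in \<open>auto simp: B_def\<close>)
    have "norm (trunc x \<gamma>1 R - trunc x \<gamma>2 R) = 1 / (2 * pi) *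
        norm (?I (Complex \<gamma>1 (-R)) (Complex \<gamma>2 (-R)) - ?I (Complex \<gamma>1 R) (Complex \<gamma>2 R))"
      unfolding eq norm_mult by (simp add: norm_divide norm_mult)
    also have "\<dots> \<le> 1 / 2 * (C * (1 + R) powr (- \<epsilon>) * B * (\<gamma>2 - \<gamma>1) + C * (1 + R) powr (- \<epsilon>) * B * (\<gamma>2 - \<gamma>1))"
      using h[of R] h[of "-R"] R pi_ge_two
      by (intro mult_mono divide_left_mono order.trans[OF norm_triangle_ineq4] add_mono) auto
    finally show ?thesis by (simp add: mult_ac)
  qed
  note le = this
  have "eventually (\<lambda>R. norm (trunc x \<gamma>1 R - trunc x \<gamma>2 R) \<le> (C * B * (\<gamma>2 - \<gamma>1)) * (1 + R) powr (- \<epsilon>)) at_top"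
    using eventually_gt_at_top[of "0::real"] by eventually_elim (rule le)
  thus ?thesis by (rule Lim_null_comparison) (rule tendsto_one_plus_powr_at_top[OF \<epsilon>(1)])
qed

text \<open>Copies the description in \<open>meijer_G\<close>, so that Meijer's function is an
  instance by rewriting.\<close>

definition inverse_mellin :: "real \<Rightarrow> complex" where
  "inverse_mellin x = (THE g. \<forall>\<gamma>>\<alpha>. (trunc x \<gamma> \<longlongrightarrow> g) at_top)"

text \<open>The limit at the single abscissa \<alpha> + 1 exists and determines the value;
  \<open>trunc_shift\<close> carries it to every other abscissa, on either side.\<close>

lemma trunc_tendsto:
  assumes x: "0 < x" "x < 1" and "\<alpha> < \<gamma>"
  shows "(trunc x \<gamma> \<longlongrightarrow> inverse_mellin x) at_top"
proof -
  obtain g where g: "(trunc x (\<alpha> + 1) \<longlongrightarrow> g) at_top"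
    using trunc_converges[of "\<alpha> + 1" x] x by auto
  have all: "(trunc x \<gamma> \<longlongrightarrow> g) at_top" if "\<alpha> < \<gamma>" for \<gamma>
  proof (cases "\<gamma> \<le> \<alpha> + 1")
    case True
    from tendsto_add[OF trunc_shift[OF that True x] g] show ?thesis by simp
  next
    case False
    from tendsto_diff[OF g trunc_shift[of "\<alpha> + 1" \<gamma> x]] False x show ?thesis by simp
  qed
  have "\<forall>\<gamma>>\<alpha>. (trunc x \<gamma> \<longlongrightarrow> inverse_mellin x) at_top"
    unfolding inverse_mellin_def
  proof (rule theI)
    show "\<forall>\<gamma>>\<alpha>. (trunc x \<gamma> \<longlongrightarrow> g) at_top" using all by blast
    fix g' assume "\<forall>\<gamma>>\<alpha>. (trunc x \<gamma> \<longlongrightarrow> g') at_top"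
    hence "(trunc x (\<alpha> + 1) \<longlongrightarrow> g') at_top" by simp
    thus "g' = g" using g tendsto_unique trivial_limit_at_top_linorder by blast
  qed
  thus ?thesis using assms by blast
qed

end

section \<open>Integrals of powers over the unit interval\<close>

lemma set_integrable_Beta_Ioo:
  fixes a b :: real
  assumes "0 < a" "0 < b"
  shows "set_integrable lborel {0<..<1} (\<lambda>x. x powr (a - 1) * (1 - x) powr (b - 1))"
  by (rule set_integrable_subset[OF integrable_Beta[OF assms]]) auto

lemma set_integrable_powr_Ioo:
  fixes a :: real
  assumes "0 < a"
  shows "set_integrable lborel {0<..<1} (\<lambda>x. x powr (a - 1))"
  using set_integrable_Beta_Ioo[of a 1] assms
  by (subst set_integrable_cong[OF refl, of _ _ _ "\<lambda>x. x powr (a - 1) * (1 - x) powr (1 - 1)"]) auto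

text \<open>The antiderivative x^z / z is continuous at 0 because Re z > 0, but it is differentiated
  only in the open interval; hence the interior form of the fundamental theorem.\<close>

lemma has_integral_complex_powr:
  fixes z :: complex
  assumes "0 < Re z"
  shows "((\<lambda>x. of_real x powr (z - 1)) has_integral 1 / z) {0..1}"
proof -
  have z: "z \<noteq> 0" using assms by auto
  have "((\<lambda>x. of_real x powr (z - 1)) has_integral of_real 1 powr z / z - of_real 0 powr z / z) {0..1}"
  proof (rule fundamental_theorem_of_calculus_interior)
    show "continuous_on {0..1} (\<lambda>x. of_real x powr z / z)"
      using assms z by (intro continuous_intros) auto
    fix x :: real assume x: "x \<in> {0<..<1}"
    have "((\<lambda>w. w powr z / z) has_field_derivative z * of_real x powr (z - 1) / z) (at (of_real x))"
      using x z by (intro DERIV_cdivide has_field_derivative_powr) (auto simp: complex_nonpos_Reals_iff)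
    from has_vector_derivative_real_field[OF this]
    show "((\<lambda>x. of_real x powr z / z) has_vector_derivative of_real x powr (z - 1)) (at x)"
      using z by simp
  qed auto
  thus ?thesis by simp
qed

text \<open>With z = s - w this produces the Cauchy kernel 1 / (s - w), on a line Re w = \<gamma>
  with \<gamma> < s.\<close>

lemma set_lebesgue_integral_complex_powr:
  fixes z :: complex
  assumes "0 < Re z"
  shows "set_integrable lborel {0<..<1} (\<lambda>x. of_real x powr (z - 1))"
    and "(LINT x:{0<..<1}|lborel. of_real x powr (z - 1)) = 1 / z"
proof -
  show *: "set_integrable lborel {0<..<1} (\<lambda>x. of_real x powr (z - 1))"
    unfolding set_integrable_def
  proof (rule Bochner_Integration.integrable_bound)
    show "integrable lborel (\<lambda>x. indicator {0<..<1} x *\<^sub>R (x powr (Re z - 1)))"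
      using set_integrable_powr_Ioo[OF assms] unfolding set_integrable_def .
    have "(\<lambda>x. indicator {0<..<1} x *\<^sub>R of_real x powr (z - 1)) \<in> borel_measurable borel"
      by (rule borel_measurable_continuous_on_indicator)
        (auto intro!: continuous_intros simp: complex_nonpos_Reals_iff)
    thus "(\<lambda>x. indicator {0<..<1} x *\<^sub>R of_real x powr (z - 1)) \<in> borel_measurable lborel"
      by simp
  qed (auto simp: indicator_def norm_powr_real_powr)
  show "(LINT x:{0<..<1}|lborel. of_real x powr (z - 1)) = 1 / z"
    using set_borel_integral_eq_integral(2)[OF *] has_integral_complex_powr[OF assms]
    by (simp add: has_integral_Icc_iff_Ioo integral_unique)
qed

section \<open>Cauchy's formula on a vertical line and the Mellin transform of the inversion
  integral\<close>

context mellin_kernel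
begin

text \<open>The line segment is the left side of a rectangle reaching to Re w = R. The right side
  has length 2R and kernel at most 2/R; the horizontal sides have length at most 2R and kernel at
  most 1/R. With the decay of \<phi> the three are O(R^(-\<epsilon>)), with constants 4 + 2 + 2 =
  8.\<close>

lemma cauchy_integral_half_plane:
  assumes \<gamma>: "\<alpha> < \<gamma>" "\<gamma> < s"
  shows "((\<lambda>R. 1 / (2 * of_real pi) * integral {-R..R} (\<lambda>t. \<phi> (Complex \<gamma> t) / (of_real s - Complex \<gamma> t)))
            \<longlongrightarrow> \<phi> (of_real s)) at_top"
proof -
  obtain C where C: "0 \<le> C" "\<And>s. \<gamma> \<le> Re s \<Longrightarrow> norm (\<phi> s) \<le> C * (1 + norm s) powr (- \<epsilon>)"
    using decay[OF \<gamma>(1)] by blast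
  define J where "J = (\<lambda>R. 1 / (2 * of_real pi) * integral {-R..R} (\<lambda>t. \<phi> (Complex \<gamma> t) / (of_real s - Complex \<gamma> t)))"
  \<comment> \<open>The lower bound on R places s inside the rectangle and gives R - s >= R / 2 and
    R - \<gamma> <= 2R.\<close>
  have "norm (J R - \<phi> (of_real s)) \<le> (8 * C) * (1 + R) powr (- \<epsilon>)" if R: "1 + 2 * \<bar>s\<bar> + \<bar>\<gamma>\<bar> < R" for R
  proof -
    define g where "g = (\<lambda>w. 1 / (w - of_real s :: complex))"
    let ?f = "\<lambda>w. \<phi> w * g w"
    let ?I = "\<lambda>a b. contour_integral (linepath a b) ?f"
    let ?p = "rectpath (Complex \<gamma> (-R)) (Complex R R)"
    have R': "0 < R" "\<gamma> < R" "s < R" "R / 2 \<le> R - s" using R by auto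
    have im: "path_image ?p = cbox (Complex \<gamma> (-R)) (Complex R R) - box (Complex \<gamma> (-R)) (Complex R R)"
      using R' by (intro path_image_rectpath_cbox_minus_box) auto
    have s: "of_real s \<in> box (Complex \<gamma> (-R)) (Complex R R)"
      using R' \<gamma> by (auto simp: in_box_complex_iff)
    have sub: "path_image ?p \<subseteq> {s. \<alpha> < Re s} - {of_real s}"
      using s \<gamma> unfolding im by (auto simp: in_cbox_complex_iff)
    have "((\<lambda>w. \<phi> w / (w - of_real s)) has_contour_integral (2 * pi * \<i> * winding_number ?p (of_real s) * \<phi> (of_real s))) ?p"
      by (rule Cauchy_integral_formula_convex_simple[OF _ holo])
        (use sub \<gamma> in \<open>auto simp: convex_halfspace_Re_gt interior_open open_half\<close>)
    moreover have "winding_number ?p (of_real s) = 1" by (rule winding_number_rectpath[OF s])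
    ultimately have "contour_integral ?p ?f = 2 * pi * \<i> * \<phi> (of_real s)"
      by (intro contour_integral_unique) (simp add: g_def)
    moreover have cont: "continuous_on ({s. \<alpha> < Re s} - {of_real s}) ?f"
      unfolding g_def by (intro continuous_intros continuous_on_subset[OF cont_\<phi>]) auto
    ultimately have eq: "?I (Complex \<gamma> (-R)) (Complex \<gamma> R) =
       ?I (Complex \<gamma> (-R)) (Complex R (-R)) + ?I (Complex R (-R)) (Complex R R)
       - ?I (Complex \<gamma> R) (Complex R R) - 2 * pi * \<i> * \<phi> (of_real s)"
      using contour_integral_rectpath_eq[OF continuous_on_subset[OF cont sub]] by (simp add: algebra_simps)
    have "?I (Complex \<gamma> (-R)) (Complex \<gamma> R) = \<i> * integral {-R..R} (\<lambda>t. ?f (Complex \<gamma> t))"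
      by (rule contour_integral_linepath_same_Re) (use R' in auto)
    also have "(\<lambda>t. ?f (Complex \<gamma> t)) = (\<lambda>t. - (\<phi> (Complex \<gamma> t) / (of_real s - Complex \<gamma> t)))"
      unfolding g_def by (rule ext) (simp add: minus_divide_right)
    \<comment> \<open>The minus sign from replacing w - s by s - w compensates that the positively
      oriented rectangle runs down its left side.\<close>
    finally have "?I (Complex \<gamma> (-R)) (Complex \<gamma> R) = - \<i> * (2 * of_real pi * J R)"
      by (simp add: J_def)
    hence "2 * of_real pi * \<i> * (J R - \<phi> (of_real s)) =
       - (?I (Complex \<gamma> (-R)) (Complex R (-R)) + ?I (Complex R (-R)) (Complex R R) - ?I (Complex \<gamma> R) (Complex R R))"
      unfolding eq by (simp add: algebra_simps)
    hence "norm (2 * of_real pi * \<i> * (J R - \<phi> (of_real s))) =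
       norm (?I (Complex \<gamma> (-R)) (Complex R (-R)) + ?I (Complex R (-R)) (Complex R R) - ?I (Complex \<gamma> R) (Complex R R))"
      by (metis norm_minus_cancel)
    also have "\<dots> \<le> norm (?I (Complex \<gamma> (-R)) (Complex R (-R))) + norm (?I (Complex R (-R)) (Complex R R)) + norm (?I (Complex \<gamma> R) (Complex R R))"
      by (intro order.trans[OF norm_triangle_ineq4] add_mono norm_triangle_ineq order_refl)
    also have "norm (?I (Complex R (-R)) (Complex R R)) \<le> C * (1 + R) powr (- \<epsilon>) * (2 / R) * norm (Complex R R - Complex R (-R))"
    proof (rule contour_integral_bound_linepath)
      have seg: "Re w = R" if "w \<in> closed_segment (Complex R (-R)) (Complex R R)" for w
        using that by (auto simp: closed_segment_same_Re)
      show "?f contour_integrable_on linepath (Complex R (- R)) (Complex R R)"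
        using seg R' \<gamma> by (intro contour_integrable_continuous_linepath continuous_on_subset[OF cont]) force
      fix w assume w: "w \<in> closed_segment (Complex R (-R)) (Complex R R)"
      have nw: "R \<le> norm w" using complex_Re_le_cmod[of w] seg[OF w] by simp
      have "norm (\<phi> w) \<le> C * (1 + norm w) powr (- \<epsilon>)" using C seg[OF w] R' by simp
      also have "\<dots> \<le> C * (1 + R) powr (- \<epsilon>)"
        using nw \<epsilon> C R' by (intro mult_left_mono powr_mono2') auto
      finally have a: "norm (\<phi> w) \<le> C * (1 + R) powr (- \<epsilon>)" .
      have "R / 2 \<le> norm (w - of_real s)"
        using complex_Re_le_cmod[of "w - of_real s"] seg[OF w] R' by simp
      hence "norm (g w) \<le> 2 / R" unfolding g_def norm_divide
        using R' by (simp add: divide_simps split: if_splits)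
      with a show "norm (?f w) \<le> C * (1 + R) powr (- \<epsilon>) * (2 / R)"
        unfolding norm_mult using C by (intro mult_mono) auto
    qed (use C R' in auto)
    also have "norm (Complex R R - Complex R (-R)) = 2 * R"
      using R' by (subst cmod_eq_Im) auto
    also have "C * (1 + R) powr (- \<epsilon>) * (2 / R) * (2 * R) = 4 * (C * (1 + R) powr (- \<epsilon>))"
      using R' by simp
    finally have main: "norm (2 * of_real pi * \<i> * (J R - \<phi> (of_real s))) \<le>
       norm (?I (Complex \<gamma> (-R)) (Complex R (-R))) + 4 * (C * (1 + R) powr (- \<epsilon>)) + norm (?I (Complex \<gamma> R) (Complex R R))"
      by simp
    have h: "norm (?I (Complex \<gamma> T) (Complex R T)) \<le> 2 * (C * (1 + R) powr (- \<epsilon>))" if T: "\<bar>T\<bar> = R" for T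
    proof -
      have im: "Im w = T" "\<gamma> \<le> Re w" if "w \<in> closed_segment (Complex \<gamma> T) (Complex R T)" for w
        using that R' by (auto simp: closed_segment_same_Im closed_segment_eq_real_ivl)
      have "norm (?I (Complex \<gamma> T) (Complex R T)) \<le> C * (1 + \<bar>T\<bar>) powr (- \<epsilon>) * (1 / R) * (R - \<gamma>)"
      proof (rule horizontal_bound)
        fix w assume w: "w \<in> closed_segment (Complex \<gamma> T) (Complex R T)"
        have "R \<le> norm (w - of_real s)"
          using abs_Im_le_cmod[of "w - of_real s"] im[OF w] T by simp
        thus "norm (g w) \<le> 1 / R" unfolding g_def norm_divide
          using R' by (simp add: divide_simps split: if_splits)
      next
        have "w \<noteq> of_real s" if "w \<in> closed_segment (Complex \<gamma> T) (Complex R T)" for w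
          using im[OF that] T R' by auto
        thus "continuous_on (closed_segment (Complex \<gamma> T) (Complex R T)) g"
          unfolding g_def by (intro continuous_intros) auto
      qed (use \<gamma> R' C in auto)
      also have "\<dots> = C * (1 + R) powr (- \<epsilon>) * ((R - \<gamma>) / R)" using T by simp
      also have "\<dots> \<le> C * (1 + R) powr (- \<epsilon>) * 2"
        using C R R' by (intro mult_left_mono) (auto simp: divide_le_eq)
      finally show ?thesis by simp
    qed
    have "2 * pi * norm (J R - \<phi> (of_real s)) \<le> 8 * (C * (1 + R) powr (- \<epsilon>))"
      using main h[of R] h[of "-R"] R' by (simp add: norm_mult)
    moreover have "1 * norm (J R - \<phi> (of_real s)) \<le> 2 * pi * norm (J R - \<phi> (of_real s))"
      using pi_ge_two by (intro mult_right_mono) auto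
    ultimately show ?thesis by simp
  qed
  note le = this
  have "eventually (\<lambda>R. norm (J R - \<phi> (of_real s)) \<le> (8 * C) * (1 + R) powr (- \<epsilon>)) at_top"
    using eventually_gt_at_top[of "1 + 2 * \<bar>s\<bar> + \<bar>\<gamma>\<bar>"] by eventually_elim (rule le)
  hence "((\<lambda>R. J R - \<phi> (of_real s)) \<longlongrightarrow> 0) at_top"
    by (rule Lim_null_comparison) (rule tendsto_one_plus_powr_at_top[OF \<epsilon>(1)])
  hence "(J \<longlongrightarrow> \<phi> (of_real s)) at_top" by (rule Lim_null[THEN iffD2])
  thus ?thesis unfolding J_def .
qed

text \<open>The real power and the exponential replace the complex power x^(-w). Joint measurability
  is then immediate, and the modulus splits into a function of x and a function of t.\<close>

definition mellin_integrand :: "real \<Rightarrow> real \<Rightarrow> real \<Rightarrow> real \<Rightarrow> real \<Rightarrow> complex" where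
  "mellin_integrand s \<gamma> R x t =
     indicator {0<..<1} x *\<^sub>R indicator {-R..R} t *\<^sub>R
       (of_real (x powr (s - 1 - \<gamma>)) * (\<phi> (Complex \<gamma> t) * exp (\<i> * of_real (- ln x * t))))"

text \<open>The first form is integrated over t and gives \<open>trunc\<close>; the second is
  integrated over x and gives the Cauchy kernel.\<close>

lemma mellin_integrand_eq:
  assumes "x \<in> {0<..<1}"
  shows "of_real (x powr (s - 1 - \<gamma>)) * (\<phi> (Complex \<gamma> t) * exp (\<i> * of_real (- ln x * t))) =
      of_real (x powr (s - 1)) * (\<phi> (Complex \<gamma> t) * of_real x powr (- Complex \<gamma> t))"
    and "of_real (x powr (s - 1 - \<gamma>)) * (\<phi> (Complex \<gamma> t) * exp (\<i> * of_real (- ln x * t))) =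
      \<phi> (Complex \<gamma> t) * of_real x powr (of_real s - Complex \<gamma> t - 1)"
proof -
  have x: "0 < x" using assms by simp
  show 1: "of_real (x powr (s - 1 - \<gamma>)) * (\<phi> (Complex \<gamma> t) * exp (\<i> * of_real (- ln x * t))) =
      of_real (x powr (s - 1)) * (\<phi> (Complex \<gamma> t) * of_real x powr (- Complex \<gamma> t))"
  proof -
    have "x powr (s - 1 - \<gamma>) = x powr (s - 1) * x powr (- \<gamma>)" by (simp flip: powr_add)
    thus ?thesis unfolding powr_of_real_Complex[OF x] by (simp add: mult_ac)
  qed
  have "of_real (x powr (s - 1)) = (of_real x powr (of_real s - 1) :: complex)"
    using x by (simp flip: powr_of_real)
  thus "of_real (x powr (s - 1 - \<gamma>)) * (\<phi> (Complex \<gamma> t) * exp (\<i> * of_real (- ln x * t))) =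
      \<phi> (Complex \<gamma> t) * of_real x powr (of_real s - Complex \<gamma> t - 1)"
    unfolding 1 by (simp add: mult_ac flip: powr_add) (simp add: algebra_simps)
qed

lemma continuous_line:
  assumes "\<alpha> < \<gamma>"
  shows "continuous_on UNIV (\<lambda>t. \<phi> (Complex \<gamma> t))"
  by (intro continuous_on_compose2[OF cont_\<phi>])
    (use assms in \<open>auto simp: Complex_eq intro!: continuous_intros\<close>)

text \<open>The modulus is the product of x^(s - \<gamma> - 1), integrable at 0 because \<gamma> <
  s, and |\<phi>| on a bounded segment of the line, where continuity suffices.\<close>

lemma integrable_mellin_integrand:
  assumes \<gamma>: "\<alpha> < \<gamma>" "\<gamma> < s"
  shows "integrable (lborel \<Otimes>\<^sub>M lborel) (case_prod (mellin_integrand s \<gamma> R))"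
proof (rule lborel_pair.Fubini_integrable)
  have [measurable]: "(\<lambda>t. \<phi> (Complex \<gamma> t)) \<in> borel_measurable borel"
    by (rule borel_measurable_continuous_onI[OF continuous_line[OF \<gamma>(1)]])
  show "case_prod (mellin_integrand s \<gamma> R) \<in> borel_measurable (lborel \<Otimes>\<^sub>M lborel)"
    unfolding mellin_integrand_def by measurable
  have line: "set_integrable lborel {-R..R} (\<lambda>t. \<phi> (Complex \<gamma> t) * exp (\<i> * of_real (- ln x * t)))" for x
    by (intro borel_integrable_atLeastAtMost' continuous_intros continuous_on_subset[OF continuous_line[OF \<gamma>(1)]]) auto
  show "AE x in lborel. integrable lborel (\<lambda>t. case_prod (mellin_integrand s \<gamma> R) (x, t))"
  proof (rule AE_I2)
    fix x :: real
    have "integrable lborel (\<lambda>t. (indicator {0<..<1} x *\<^sub>R of_real (x powr (s - 1 - \<gamma>))) *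
        (indicator {-R..R} t *\<^sub>R (\<phi> (Complex \<gamma> t) * exp (\<i> * of_real (- ln x * t)))))"
      using line[of x] unfolding set_integrable_def by (rule integrable_mult_right)
    thus "integrable lborel (\<lambda>t. case_prod (mellin_integrand s \<gamma> R) (x, t))"
      by (simp add: mellin_integrand_def scaleR_conv_of_real mult_ac)
  qed
  have "integrable lborel (\<lambda>x. (indicator {0<..<1} x *\<^sub>R (x powr (s - \<gamma> - 1))) * (LINT t|lborel. indicator {-R..R} t * norm (\<phi> (Complex \<gamma> t))))"
    using set_integrable_powr_Ioo[of "s - \<gamma>"] \<gamma> unfolding set_integrable_def by (intro integrable_mult_left) simp
  moreover have "(\<lambda>x. LINT t|lborel. norm (case_prod (mellin_integrand s \<gamma> R) (x, t))) =
      (\<lambda>x. (indicator {0<..<1} x *\<^sub>R (x powr (s - \<gamma> - 1))) * (LINT t|lborel. indicator {-R..R} t * norm (\<phi> (Complex \<gamma> t))))"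
    by (subst Bochner_Integration.integral_mult_right_zero[symmetric])
      (auto simp: mellin_integrand_def norm_mult fun_eq_iff algebra_simps intro!: Bochner_Integration.integral_cong)
  ultimately show "integrable lborel (\<lambda>x. LINT t|lborel. norm (case_prod (mellin_integrand s \<gamma> R) (x, t)))"
    by simp
qed

lemma integral_mellin_integrand_t:
  assumes \<gamma>: "\<alpha> < \<gamma>" and R: "0 < R"
  shows "(LINT t|lborel. mellin_integrand s \<gamma> R x t) =
     indicator {0<..<1} x *\<^sub>R (2 * of_real pi * (of_real (x powr (s - 1)) * trunc x \<gamma> R))"
proof (cases "x \<in> {0<..<1}")
  case True
  have c: "continuous_on {-R..R} (\<lambda>t. \<phi> (Complex \<gamma> t) * of_real x powr (- Complex \<gamma> t))"
    using True by (intro continuous_intros continuous_on_subset[OF continuous_line[OF \<gamma>]])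
      (auto simp: Complex_eq intro!: continuous_intros)
  have si: "set_integrable lborel {-R..R} (\<lambda>t. \<phi> (Complex \<gamma> t) * of_real x powr (- Complex \<gamma> t))"
    by (rule borel_integrable_atLeastAtMost'[OF c])
  have "(LINT t|lborel. mellin_integrand s \<gamma> R x t) =
     (LINT t|lborel. of_real (x powr (s - 1)) * (indicator {-R..R} t *\<^sub>R (\<phi> (Complex \<gamma> t) * of_real x powr (- Complex \<gamma> t))))"
    unfolding mellin_integrand_def mellin_integrand_eq(1)[OF True] using True by (simp add: scaleR_conv_of_real mult_ac)
  also have "\<dots> = of_real (x powr (s - 1)) * (LINT t:{-R..R}|lborel. \<phi> (Complex \<gamma> t) * of_real x powr (- Complex \<gamma> t))"
    unfolding set_lebesgue_integral_def by (rule integral_mult_right_zero)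
  also have "(LINT t:{-R..R}|lborel. \<phi> (Complex \<gamma> t) * of_real x powr (- Complex \<gamma> t)) = 2 * of_real pi * trunc x \<gamma> R"
    using set_borel_integral_eq_integral(2)[OF si] by (simp add: trunc_eq_integral[OF R])
  finally show ?thesis using True by simp
qed (simp add: mellin_integrand_def)

lemma integral_mellin_integrand_x:
  assumes "\<gamma> < s"
  shows "(LINT x|lborel. mellin_integrand s \<gamma> R x t) =
     indicator {-R..R} t *\<^sub>R (\<phi> (Complex \<gamma> t) / (of_real s - Complex \<gamma> t))"
proof -
  have "(LINT x|lborel. mellin_integrand s \<gamma> R x t) =
    (LINT x|lborel. (indicator {-R..R} t *\<^sub>R \<phi> (Complex \<gamma> t)) * (indicator {0<..<1} x *\<^sub>R of_real x powr (of_real s - Complex \<gamma> t - 1)))"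
  proof (intro Bochner_Integration.integral_cong refl)
    fix x :: real
    show "mellin_integrand s \<gamma> R x t = (indicator {-R..R} t *\<^sub>R \<phi> (Complex \<gamma> t)) *
        (indicator {0<..<1} x *\<^sub>R of_real x powr (of_real s - Complex \<gamma> t - 1))"
    proof (cases "x \<in> {0<..<1}")
      case True
      show ?thesis unfolding mellin_integrand_def mellin_integrand_eq(2)[OF True] using True by simp
    qed (simp add: mellin_integrand_def)
  qed
  also have "\<dots> = (indicator {-R..R} t *\<^sub>R \<phi> (Complex \<gamma> t)) * (LINT x:{0<..<1}|lborel. of_real x powr (of_real s - Complex \<gamma> t - 1))"
    unfolding set_lebesgue_integral_def by (rule integral_mult_right_zero)
  also have "(LINT x:{0<..<1}|lborel. of_real x powr (of_real s - Complex \<gamma> t - 1)) = 1 / (of_real s - Complex \<gamma> t)"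
    by (rule set_lebesgue_integral_complex_powr) (use assms in simp)
  finally show ?thesis by (cases "t \<in> {-R..R}") simp_all
qed

theorem mellin_inverse_mellin:
  assumes s: "\<alpha> < s"
  shows "set_integrable lborel {0<..<1} (\<lambda>x. of_real (x powr (s - 1)) * inverse_mellin x)"
    and "(LINT x:{0<..<1}|lborel. of_real (x powr (s - 1)) * inverse_mellin x) = \<phi> (of_real s)"
proof -
  \<comment> \<open>The abscissa must lie right of \<alpha> for the bound on \<open>trunc\<close>
    and left of s for integrability at x = 0.\<close>
  define \<gamma> where "\<gamma> = (\<alpha> + s) / 2"
  have \<gamma>: "\<alpha> < \<gamma>" "\<gamma> < s" using s by (auto simp: \<gamma>_def)
  obtain K where K: "0 \<le> K" "\<And>x R. 0 < x \<Longrightarrow> x < 1 \<Longrightarrow> 0 < R \<Longrightarrow>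
           norm (trunc x \<gamma> R) \<le> K * (x powr (- \<gamma>) * (1 - x) powr (\<epsilon> - 1))"
    using trunc_bound[OF \<gamma>(1)] by blast
  \<comment> \<open>Truncation at n + 1, because the formulas for \<open>trunc\<close> require R >
    0.\<close>
  define F where "F = (\<lambda>n x. indicator {0<..<1} x *\<^sub>R (of_real (x powr (s - 1)) * trunc x \<gamma> (real (Suc n))))"
  define w where "w = (\<lambda>x. K * (indicator {0<..<1} x *\<^sub>R (x powr (s - \<gamma> - 1) * (1 - x) powr (\<epsilon> - 1))))"
  have F_eq: "F n = (\<lambda>x. (1 / (2 * of_real pi)) * (LINT t|lborel. mellin_integrand s \<gamma> (real (Suc n)) x t))" for n
    unfolding F_def integral_mellin_integrand_t[OF \<gamma>(1) of_nat_0_less_iff[THEN iffD2, OF zero_less_Suc]]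
    by (rule ext) simp
  \<comment> \<open>As an inner integral of a jointly integrable function, F n is measurable by
    Fubini.\<close>
  have F_meas: "F n \<in> borel_measurable lborel" for n
    unfolding F_eq
    by (intro borel_measurable_times borel_measurable_const borel_measurable_integrable
         lborel_pair.integrable_fst[of "mellin_integrand s \<gamma> (real (Suc n))"] integrable_mellin_integrand \<gamma>)
  have suc: "filterlim (\<lambda>n. real (Suc n)) at_top sequentially"
    by (rule filterlim_compose[OF filterlim_real_sequentially filterlim_Suc])
  have F_lim: "(\<lambda>n. F n x) \<longlonglongrightarrow> indicator {0<..<1} x *\<^sub>R (of_real (x powr (s - 1)) * inverse_mellin x)" for x
  proof (cases "x \<in> {0<..<1}")
    case True
    have "(\<lambda>n. trunc x \<gamma> (real (Suc n))) \<longlonglongrightarrow> inverse_mellin x"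
      using True by (intro filterlim_compose[OF trunc_tendsto suc] \<gamma>) auto
    thus ?thesis unfolding F_def by (intro tendsto_intros)
  qed (simp add: F_def)
  have F_bound: "norm (F n x) \<le> w x" for n x
  proof (cases "x \<in> {0<..<1}")
    case True
    have "norm (F n x) = x powr (s - 1) * norm (trunc x \<gamma> (real (Suc n)))"
      using True by (simp add: F_def norm_mult)
    also have "\<dots> \<le> x powr (s - 1) * (K * (x powr (- \<gamma>) * (1 - x) powr (\<epsilon> - 1)))"
      using True by (intro mult_left_mono K) auto
    also have "\<dots> = w x"
    proof -
      have "x powr (s - \<gamma> - 1) = x powr (s - 1) * x powr (- \<gamma>)" by (simp flip: powr_add add: algebra_simps)
      thus ?thesis using True by (simp add: w_def)
    qed
    finally show ?thesis .
  qed (simp add: F_def w_def)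
  have w_int: "integrable lborel w"
    using set_integrable_Beta_Ioo[of "s - \<gamma>" \<epsilon>] \<gamma> \<epsilon> unfolding w_def set_integrable_def
    by (intro integrable_mult_right) simp
  \<comment> \<open>The description operator in \<open>inverse_mellin\<close> says nothing on
    measurability; the pointwise limit provides it.\<close>
  have G_meas: "(\<lambda>x. indicator {0<..<1} x *\<^sub>R (of_real (x powr (s - 1)) * inverse_mellin x)) \<in> borel_measurable lborel"
    by (rule borel_measurable_LIMSEQ_metric[OF F_meas F_lim])
  note dom = G_meas F_meas w_int AE_I2[OF F_lim] AE_I2[OF F_bound]
  show "set_integrable lborel {0<..<1} (\<lambda>x. of_real (x powr (s - 1)) * inverse_mellin x)"
    unfolding set_integrable_def by (rule integrable_dominated_convergence[OF dom])
  have lim: "(\<lambda>n. LINT x|lborel. F n x) \<longlonglongrightarrow> (LINT x:{0<..<1}|lborel. of_real (x powr (s - 1)) * inverse_mellin x)"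
    unfolding set_lebesgue_integral_def by (rule integral_dominated_convergence[OF dom])
  have "(LINT x|lborel. F n x) = 1 / (2 * of_real pi) *
      integral {-real (Suc n)..real (Suc n)} (\<lambda>t. \<phi> (Complex \<gamma> t) / (of_real s - Complex \<gamma> t))" for n
  proof -
    let ?R = "real (Suc n)"
    have "of_real s \<noteq> Complex \<gamma> t" for t using \<gamma> by (auto simp: complex_eq_iff)
    hence c: "continuous_on {-?R..?R} (\<lambda>t. \<phi> (Complex \<gamma> t) / (of_real s - Complex \<gamma> t))"
      by (intro continuous_intros continuous_on_subset[OF continuous_line[OF \<gamma>(1)]])
        (auto simp: Complex_eq intro!: continuous_intros)
    have si: "set_integrable lborel {-?R..?R} (\<lambda>t. \<phi> (Complex \<gamma> t) / (of_real s - Complex \<gamma> t))"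
      by (rule borel_integrable_atLeastAtMost'[OF c])
    have "(LINT x|lborel. F n x) = 1 / (2 * of_real pi) * (LINT x|lborel. LINT t|lborel. mellin_integrand s \<gamma> ?R x t)"
      unfolding F_eq by (rule integral_mult_right_zero)
    also have "(LINT x|lborel. LINT t|lborel. mellin_integrand s \<gamma> ?R x t) =
        (LINT t|lborel. LINT x|lborel. mellin_integrand s \<gamma> ?R x t)"
      by (rule lborel_pair.Fubini_integral[symmetric]) (rule integrable_mellin_integrand[OF \<gamma>])
    also have "\<dots> = (LINT t:{-?R..?R}|lborel. \<phi> (Complex \<gamma> t) / (of_real s - Complex \<gamma> t))"
      unfolding integral_mellin_integrand_x[OF \<gamma>(2)] set_lebesgue_integral_def ..
    also have "\<dots> = integral {-?R..?R} (\<lambda>t. \<phi> (Complex \<gamma> t) / (of_real s - Complex \<gamma> t))"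
      by (rule set_borel_integral_eq_integral(2)[OF si])
    finally show ?thesis .
  qed
  moreover have "(\<lambda>n. 1 / (2 * of_real pi) *
      integral {-real (Suc n)..real (Suc n)} (\<lambda>t. \<phi> (Complex \<gamma> t) / (of_real s - Complex \<gamma> t))) \<longlonglongrightarrow> \<phi> (of_real s)"
    by (rule filterlim_compose[OF cauchy_integral_half_plane[OF \<gamma>] suc])
  ultimately have "(\<lambda>n. LINT x|lborel. F n x) \<longlonglongrightarrow> \<phi> (of_real s)" by simp
  thus "(LINT x:{0<..<1}|lborel. of_real (x powr (s - 1)) * inverse_mellin x) = \<phi> (of_real s)"
    using lim LIMSEQ_unique by blast
qed

end

section \<open>Stieltjes transforms on the cut plane\<close>

lemma mem_cut_plane_iff: "z \<in> cut_plane \<longleftrightarrow> Im z \<noteq> 0 \<or> Re z < 1"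
proof -
  have "z \<in> complex_of_real ` {1..} \<longleftrightarrow> Im z = 0 \<and> 1 \<le> Re z"
    by (auto simp: image_iff complex_eq_iff intro!: exI[of _ "Re z"])
  thus ?thesis by (auto simp: cut_plane_def)
qed

lemma open_cut_plane: "open cut_plane"
proof -
  have eq: "cut_plane = - ({z. Im z = 0} \<inter> {z. Re z \<ge> 1})"
    by (auto simp: mem_cut_plane_iff)
  show ?thesis
    unfolding eq by (intro open_Compl closed_Int closed_Collect_eq closed_halfspace_Re_ge continuous_intros)
qed

lemma connected_cut_plane: "connected cut_plane"
proof (rule starlike_imp_connected)
  have "closed_segment 0 z \<subseteq> cut_plane" if z: "z \<in> cut_plane" for z
  proof
    fix w assume "w \<in> closed_segment 0 z"
    then obtain t where t: "0 \<le> t" "t \<le> 1" "w = of_real t * z"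
      by (auto simp: closed_segment_def scaleR_conv_of_real)
    have "t * Re z < 1" if "Re z < 1"
    proof (cases "Re z \<le> 0")
      case True
      thus ?thesis using t mult_nonneg_nonpos[of t "Re z"] by linarith
    next
      case False
      thus ?thesis using t that mult_left_le_one_le[of "Re z" t] by linarith
    qed
    thus "w \<in> cut_plane" using z t by (auto simp: mem_cut_plane_iff)
  qed
  thus "starlike cut_plane"
    unfolding starlike_def by (intro bexI[of _ 0]) (auto simp: mem_cut_plane_iff)
qed

lemma ball_subset_cut_plane: "ball 0 1 \<subseteq> cut_plane"
proof
  fix z :: complex assume "z \<in> ball 0 1"
  thus "z \<in> cut_plane" using complex_Re_le_cmod[of z] by (simp add: mem_cut_plane_iff)
qed

text \<open>The identity theorem, from the disc to the connected cut plane, gives the uniqueness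
  that the description in \<open>hypergeo\<close> requires.\<close>

lemma hypergeo_eqI:
  assumes "f holomorphic_on cut_plane"
    and "\<And>u. norm u < 1 \<Longrightarrow> f u = eval_fps (fps_hypergeo as bs 1) u"
    and "z \<in> cut_plane"
  shows "hypergeo as bs z = f z"
  unfolding hypergeo_def
proof (rule the_equality)
  show "\<exists>g. g holomorphic_on cut_plane \<and> (\<forall>u\<in>ball 0 1. g u = eval_fps (fps_hypergeo as bs 1) u) \<and> f z = g z"
    using assms by (intro exI[of _ f]) auto
  fix w assume "\<exists>g. g holomorphic_on cut_plane \<and> (\<forall>u\<in>ball 0 1. g u = eval_fps (fps_hypergeo as bs 1) u) \<and> w = g z"
  then obtain g where g: "g holomorphic_on cut_plane" "\<And>u. u \<in> ball 0 1 \<Longrightarrow> g u = eval_fps (fps_hypergeo as bs 1) u" "w = g z"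
    by blast
  have "g z = f z"
    by (rule analytic_continuation_open[of "ball 0 1" cut_plane g f])
      (use assms g open_cut_plane connected_cut_plane ball_subset_cut_plane in auto)
  thus "w = f z" using g by simp
qed

text \<open>A zero of 1 - xu with x in [0, 1] would put u = 1/x on the cut. So the minimum 2\<delta>
  over the compact interval is positive, and moving u by less than \<delta> costs less than \<delta>
  because x <= 1.\<close>

lemma cut_plane_kernel_bound:
  assumes "u \<in> cut_plane"
  obtains \<delta> where "0 < \<delta>" "\<And>x v. 0 \<le> x \<Longrightarrow> x \<le> 1 \<Longrightarrow> norm (v - u) < \<delta> \<Longrightarrow> \<delta> \<le> norm (1 - of_real x * v)"
proof -
  have "continuous_on {0..1::real} (\<lambda>x. norm (1 - of_real x * u))" by (intro continuous_intros)
  from continuous_attains_inf[OF compact_Icc _ this]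
  obtain m where m: "m \<in> {0..1}" "\<And>x. x \<in> {0..1} \<Longrightarrow> norm (1 - of_real m * u) \<le> norm (1 - of_real x * u)"
    by auto
  define \<delta> where "\<delta> = norm (1 - of_real m * u) / 2"
  have "1 - of_real m * u \<noteq> 0"
  proof
    assume "1 - of_real m * u = 0"
    hence eq: "m * Re u = 1" "m * Im u = 0" by (auto simp: complex_eq_iff)
    hence "0 < m" using m(1) by (cases "m = 0") auto
    hence "Im u = 0" using eq by simp
    moreover have "1 \<le> Re u"
    proof (rule ccontr)
      assume "\<not> 1 \<le> Re u"
      hence "m * Re u < m * 1" using \<open>0 < m\<close> by (intro mult_strict_left_mono) auto
      thus False using eq m(1) by simp
    qed
    ultimately show False using assms by (simp add: mem_cut_plane_iff)
  qed
  hence \<delta>: "0 < \<delta>" by (simp add: \<delta>_def)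
  show ?thesis
  proof (rule that[OF \<delta>])
    fix x :: real and v assume x: "0 \<le> x" "x \<le> 1" and v: "norm (v - u) < \<delta>"
    have "2 * \<delta> \<le> norm (1 - of_real x * u)" using m(2)[of x] x by (simp add: \<delta>_def)
    also have "\<dots> = norm ((1 - of_real x * v) + of_real x * (v - u))" by (simp add: algebra_simps)
    also have "\<dots> \<le> norm (1 - of_real x * v) + norm (of_real x * (v - u))" by (rule norm_triangle_ineq)
    also have "norm (of_real x * (v - u)) \<le> 1 * norm (v - u)"
      unfolding norm_mult using x by (intro mult_right_mono) auto
    finally show "\<delta> \<le> norm (1 - of_real x * v)" using v by simp
  qed
qed

locale stieltjes =
  fixes \<rho> :: "real \<Rightarrow> complex"
  assumes integrable_density: "set_integrable lborel {0<..<1} \<rho>"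
begin

text \<open>The sign suits the geometric series in xu; the theorem uses u = -z.\<close>

definition transform :: "complex \<Rightarrow> complex" where
  "transform u = (LINT x:{0<..<1}|lborel. \<rho> x / (1 - of_real x * u))"

lemma set_integrable_mult_bounded:
  fixes h :: "real \<Rightarrow> complex"
  assumes [measurable]: "h \<in> borel_measurable borel" and "\<And>x. 0 < x \<Longrightarrow> x < 1 \<Longrightarrow> norm (h x) \<le> B"
  shows "set_integrable lborel {0<..<1} (\<lambda>x. \<rho> x * h x)"
  unfolding set_integrable_def
proof (rule Bochner_Integration.integrable_bound)
  have i: "integrable lborel (\<lambda>x. indicator {0<..<1} x *\<^sub>R \<rho> x)"
    using integrable_density by (simp add: set_integrable_def)
  show "integrable lborel (\<lambda>x. B * norm (indicator {0<..<1} x *\<^sub>R \<rho> x))"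
    using integrable_norm[OF i] by (rule integrable_mult_right)
  have "(\<lambda>x. (indicator {0<..<1} x *\<^sub>R \<rho> x) * h x) \<in> borel_measurable lborel"
    using borel_measurable_integrable[OF i] by (intro borel_measurable_times) auto
  thus "(\<lambda>x. indicator {0<..<1} x *\<^sub>R (\<rho> x * h x)) \<in> borel_measurable lborel" by simp
  show "AE x in lborel. norm (indicator {0<..<1} x *\<^sub>R (\<rho> x * h x)) \<le> norm (B * norm (indicator {0<..<1} x *\<^sub>R \<rho> x))"
  proof (rule AE_I2)
    fix x :: real
    show "norm (indicator {0<..<1} x *\<^sub>R (\<rho> x * h x)) \<le> norm (B * norm (indicator {0<..<1} x *\<^sub>R \<rho> x))"
    proof (cases "x \<in> {0<..<1}")
      case True
      hence "norm (h x) \<le> \<bar>B\<bar>" using assms(2)[of x] by auto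
      hence "norm (\<rho> x) * norm (h x) \<le> norm (\<rho> x) * \<bar>B\<bar>" by (intro mult_left_mono) auto
      thus ?thesis using True by (simp add: norm_mult abs_mult mult.commute)
    qed simp
  qed
qed

lemma integrable_transform:
  assumes "u \<in> cut_plane"
  shows "set_integrable lborel {0<..<1} (\<lambda>x. \<rho> x / (1 - of_real x * u))"
proof -
  obtain \<delta> where \<delta>: "0 < \<delta>" "\<And>x v. 0 \<le> x \<Longrightarrow> x \<le> 1 \<Longrightarrow> norm (v - u) < \<delta> \<Longrightarrow> \<delta> \<le> norm (1 - of_real x * v)"
    using cut_plane_kernel_bound[OF assms] by blast
  have "set_integrable lborel {0<..<1} (\<lambda>x. \<rho> x * (1 / (1 - of_real x * u)))"
  proof (rule set_integrable_mult_bounded)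
    fix x :: real assume "0 < x" "x < 1"
    thus "norm (1 / (1 - of_real x * u)) \<le> 1 / \<delta>"
      using \<delta>(2)[of x u] \<delta>(1) by (auto simp: norm_divide intro!: divide_left_mono mult_pos_pos)
  qed simp
  thus ?thesis by simp
qed

text \<open>The difference quotient of the kernel is exactly x / ((1 - xv)(1 - xu)), bounded by 1 /
  \<delta>^2 near u, so dominated convergence applies along every sequence tending to u.\<close>

lemma transform_has_derivative:
  assumes u: "u \<in> cut_plane"
  shows "(transform has_field_derivative (LINT x:{0<..<1}|lborel. \<rho> x * (of_real x / (1 - of_real x * u)^2))) (at u)"
proof -
  obtain \<delta> where \<delta>: "0 < \<delta>" "\<And>x v. 0 \<le> x \<Longrightarrow> x \<le> 1 \<Longrightarrow> norm (v - u) < \<delta> \<Longrightarrow> \<delta> \<le> norm (1 - of_real x * v)"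
    using cut_plane_kernel_bound[OF u] by blast
  obtain r where r: "0 < r" "ball u r \<subseteq> cut_plane"
    using open_cut_plane u open_contains_ball by blast
  \<comment> \<open>The radius \<delta> secures the kernel bound, the radius r the existence of the
    transform.\<close>
  define S where "S = ball u (min \<delta> r)"
  have S: "open S" "u \<in> S" using \<delta> r by (auto simp: S_def)
  let ?D = "LINT x:{0<..<1}|lborel. \<rho> x * (of_real x / (1 - of_real x * u)^2)"
  let ?k = "\<lambda>v x. of_real x / ((1 - of_real x * v) * (1 - of_real x * u)) :: complex"
  have "((\<lambda>v. (transform v - transform u) / (v - u)) \<longlongrightarrow> ?D) (at u within S)"
    unfolding tendsto_at_iff_sequentially
  proof (intro allI impI)
    fix X :: "nat \<Rightarrow> complex" assume X: "\<forall>i. X i \<in> S - {u}" "X \<longlonglongrightarrow> u"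
    have Xn: "norm (X i - u) < \<delta>" "X i \<noteq> u" "X i \<in> cut_plane" for i
      using X(1) r by (auto simp: S_def dist_norm norm_minus_commute subset_eq)
    have nz: "1 - of_real x * v \<noteq> 0" if "x \<in> {0<..<1}" "norm (v - u) < \<delta>" for x v
      using \<delta>(2)[of x v] \<delta>(1) that by auto
    have kb: "norm (?k v x) \<le> 1 / (\<delta> * \<delta>)" if x: "x \<in> {0<..<1}" and v: "norm (v - u) < \<delta>" for x v
    proof -
      have "\<delta> * \<delta> \<le> norm (1 - of_real x * v) * norm (1 - of_real x * u)"
        using \<delta> x v by (intro mult_mono) auto
      thus ?thesis unfolding norm_divide norm_mult using x \<delta>(1) by (intro frac_le) auto
    qed
    have quot: "(transform (X i) - transform u) / (X i - u) = (LINT x:{0<..<1}|lborel. \<rho> x * ?k (X i) x)" for i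
    proof -
      have "transform (X i) - transform u = (LINT x:{0<..<1}|lborel. \<rho> x / (1 - of_real x * X i) - \<rho> x / (1 - of_real x * u))"
        unfolding transform_def by (rule set_integral_diff(2)[symmetric]) (intro integrable_transform Xn u)+
      also have "\<dots> = (LINT x:{0<..<1}|lborel. (X i - u) * (\<rho> x * ?k (X i) x))"
      proof (intro set_lebesgue_integral_cong allI impI)
        fix x :: real assume x: "x \<in> {0<..<1}"
        show "\<rho> x / (1 - of_real x * X i) - \<rho> x / (1 - of_real x * u) = (X i - u) * (\<rho> x * ?k (X i) x)"
          using nz[OF x Xn(1)[of i]] nz[OF x, of u] \<delta>(1) by (simp add: divide_simps) (simp add: algebra_simps)
      qed simp
      also have "\<dots> = (X i - u) * (LINT x:{0<..<1}|lborel. \<rho> x * ?k (X i) x)"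
        by (rule set_integral_mult_right)
      finally show ?thesis using Xn(2)[of i] by simp
    qed
    have "(\<lambda>i. LINT x:{0<..<1}|lborel. \<rho> x * ?k (X i) x) \<longlonglongrightarrow> (LINT x:{0<..<1}|lborel. \<rho> x * ?k u x)"
      unfolding set_lebesgue_integral_def
    proof (rule integral_dominated_convergence[where w = "\<lambda>x. 1 / (\<delta> * \<delta>) * norm (indicator {0<..<1} x *\<^sub>R \<rho> x)"])
      have i: "set_integrable lborel {0<..<1} (\<lambda>x. \<rho> x * ?k v x)" if "norm (v - u) < \<delta>" for v
        by (rule set_integrable_mult_bounded) (use kb that in auto)
      show "(\<lambda>x. indicator {0<..<1} x *\<^sub>R (\<rho> x * ?k u x)) \<in> borel_measurable lborel"
        "(\<lambda>x. indicator {0<..<1} x *\<^sub>R (\<rho> x * ?k (X n) x)) \<in> borel_measurable lborel" for n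
        using i[of u] i[of "X n"] Xn \<delta>(1) unfolding set_integrable_def by (auto intro: borel_measurable_integrable)
      show "integrable lborel (\<lambda>x. 1 / (\<delta> * \<delta>) * norm (indicator {0<..<1} x *\<^sub>R \<rho> x))"
        using integrable_density unfolding set_integrable_def by (intro integrable_mult_right integrable_norm)
      show "AE x in lborel. norm (indicator {0<..<1} x *\<^sub>R (\<rho> x * ?k (X n) x)) \<le> 1 / (\<delta> * \<delta>) * norm (indicator {0<..<1} x *\<^sub>R \<rho> x)" for n
      proof (rule AE_I2)
        fix x :: real
        show "norm (indicator {0<..<1} x *\<^sub>R (\<rho> x * ?k (X n) x)) \<le> 1 / (\<delta> * \<delta>) * norm (indicator {0<..<1} x *\<^sub>R \<rho> x)"
        proof (cases "x \<in> {0<..<1}")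
          case True
          have "norm (\<rho> x) * norm (?k (X n) x) \<le> norm (\<rho> x) * (1 / (\<delta> * \<delta>))"
            by (intro mult_left_mono kb True Xn) auto
          hence "norm (\<rho> x * ?k (X n) x) \<le> 1 / (\<delta> * \<delta>) * norm (\<rho> x)"
            by (simp only: norm_mult mult.commute)
          moreover have "indicator {0<..<1} x = (1::real)" using True by simp
          ultimately show ?thesis by (simp only: scaleR_one)
        qed simp
      qed
      show "AE x in lborel. (\<lambda>i. indicator {0<..<1} x *\<^sub>R (\<rho> x * ?k (X i) x)) \<longlonglongrightarrow> indicator {0<..<1} x *\<^sub>R (\<rho> x * ?k u x)"
      proof (rule AE_I2)
        fix x :: real
        show "(\<lambda>i. indicator {0<..<1} x *\<^sub>R (\<rho> x * ?k (X i) x)) \<longlonglongrightarrow> indicator {0<..<1} x *\<^sub>R (\<rho> x * ?k u x)"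
        proof (cases "x \<in> {0<..<1}")
          case True
          thus ?thesis using nz[OF True, of u] \<delta>(1) by (intro tendsto_intros X(2)) auto
        qed simp
      qed
    qed
    thus "((\<lambda>v. (transform v - transform u) / (v - u)) \<circ> X) \<longlonglongrightarrow> ?D"
      unfolding comp_def quot power2_eq_square .
  qed
  thus ?thesis
    unfolding has_field_derivative_iff at_within_open[OF S(2,1)] .
qed

lemma transform_holomorphic: "transform holomorphic_on cut_plane"
  using transform_has_derivative open_cut_plane by (auto simp: holomorphic_on_open)

text \<open>The geometric series is integrated termwise; the nth term is dominated by |\<rho>|
  |u|^n, whose integrals form a convergent series.\<close>

lemma transform_sums:
  assumes u: "norm u < 1"
  shows "(\<lambda>n. (LINT x:{0<..<1}|lborel. \<rho> x * of_real x ^ n) * u ^ n) sums transform u"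
proof -
  define f where "f = (\<lambda>n x. indicator {0<..<1} x *\<^sub>R (\<rho> x * (of_real x * u) ^ n))"
  have i0: "integrable lborel (\<lambda>x. norm (indicator {0<..<1} x *\<^sub>R \<rho> x))"
    using integrable_density unfolding set_integrable_def by (rule integrable_norm)
  have fi: "integrable lborel (f n)" for n
    unfolding f_def set_integrable_def[symmetric]
  proof (rule set_integrable_mult_bounded)
    fix x :: real assume "0 < x" "x < 1"
    hence "norm (of_real x * u) \<le> 1"
      using u mult_le_one[of x "norm u"] by (simp add: norm_mult)
    thus "norm ((of_real x * u) ^ n) \<le> 1" by (simp add: norm_power power_le_one)
  qed simp
  have fb: "norm (f n x) \<le> norm (indicator {0<..<1} x *\<^sub>R \<rho> x) * norm u ^ n" for n x
  proof (cases "x \<in> {0<..<1}")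
    case True
    hence "norm (of_real x * u) \<le> norm u" by (auto simp: norm_mult mult_left_le_one_le)
    hence "norm (of_real x * u) ^ n \<le> norm u ^ n" by (intro power_mono) auto
    thus ?thesis using True by (simp add: f_def norm_mult norm_power mult_left_mono)
  qed (simp add: f_def)
  have geo: "summable (\<lambda>n. c * norm u ^ n)" for c
    using u by (intro summable_mult summable_geometric) simp
  have "(\<lambda>n. integral\<^sup>L lborel (f n)) sums (LINT x|lborel. (\<Sum>n. f n x))"
  proof (rule sums_integral[OF fi])
    show "AE x in lborel. summable (\<lambda>n. norm (f n x))"
      by (intro AE_I2 summable_comparison_test_ev[OF _ geo] always_eventually allI) (use fb in auto)
    have "norm (LINT x|lborel. norm (f n x)) \<le> (LINT x|lborel. norm (indicator {0<..<1} x *\<^sub>R \<rho> x)) * norm u ^ n" for n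
    proof -
      have "(LINT x|lborel. norm (f n x)) \<le> (LINT x|lborel. norm (indicator {0<..<1} x *\<^sub>R \<rho> x) * norm u ^ n)"
        by (intro integral_mono integrable_norm[OF fi] integrable_mult_left i0 fb)
      thus ?thesis by simp
    qed
    thus "summable (\<lambda>n. LINT x|lborel. norm (f n x))"
      by (intro summable_comparison_test_ev[OF _ geo] always_eventually allI)
  qed
  moreover have "(\<Sum>n. f n x) = indicator {0<..<1} x *\<^sub>R (\<rho> x / (1 - of_real x * u))" for x
  proof (cases "x \<in> {0<..<1}")
    case True
    hence "norm (of_real x * u) < 1"
      using u mult_left_le_one_le[of "norm u" x] by (auto simp: norm_mult)
    from sums_unique[OF sums_mult[OF geometric_sums[OF this], of "\<rho> x"]] show ?thesis
      using True by (simp add: f_def)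
  qed (simp add: f_def)
  moreover have "integral\<^sup>L lborel (f n) = (LINT x:{0<..<1}|lborel. \<rho> x * of_real x ^ n) * u ^ n" for n
    unfolding f_def set_lebesgue_integral_def
    by (subst Bochner_Integration.integral_mult_left_zero[symmetric]) (simp add: power_mult_distrib mult_ac)
  ultimately show ?thesis by (simp add: transform_def set_lebesgue_integral_def)
qed

end

section \<open>The kernel of Meijer's function\<close>

lemma Re_nonpos_Ints: "z \<in> \<int>\<^sub>\<le>\<^sub>0 \<Longrightarrow> Re z \<le> 0"
  by (auto elim!: nonpos_Ints_cases)

text \<open>\<open>fps_hypergeo_nth\<close> expresses the coefficients as folds; this makes them
  products over lists.\<close>

lemma foldl_mult_eq_prod_list:
  fixes f :: "'b \<Rightarrow> 'a::comm_monoid_mult"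
  shows "foldl (\<lambda>r x. r * f x) v xs = v * (\<Prod>x\<leftarrow>xs. f x)"
  by (induction xs arbitrary: v) (simp_all add: mult_ac)

lemma prod_nth_divide:
  fixes f :: "'b \<Rightarrow> 'a::field"
  assumes "length xs = length ys"
  shows "(\<Prod>i<length xs. f (ys ! i) / f (xs ! i)) = (\<Prod>y\<leftarrow>ys. f y) / (\<Prod>x\<leftarrow>xs. f x)"
  using assms by (induction xs ys rule: list_induct2) (simp_all add: prod.lessThan_Suc_shift del: prod.lessThan_Suc)

lemma sum_nth_diff:
  fixes xs ys :: "'a::ab_group_add list"
  assumes "length xs = length ys"
  shows "(\<Sum>i<length xs. ys ! i - xs ! i) = sum_list ys - sum_list xs"
  using assms by (induction xs ys rule: list_induct2) (simp_all add: sum.lessThan_Suc_shift del: sum.lessThan_Suc)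

lemma prod_list_Gamma_add_of_nat:
  fixes C :: "complex list"
  assumes "\<And>c. c \<in> set C \<Longrightarrow> c \<notin> \<int>\<^sub>\<le>\<^sub>0"
  shows "(\<Prod>c\<leftarrow>C. Gamma (c + of_nat n)) = (\<Prod>c\<leftarrow>C. Gamma c) * (\<Prod>c\<leftarrow>C. pochhammer c n)"
  using assms
proof (induction C)
  case (Cons c C)
  have "Gamma (c + of_nat n) = Gamma c * pochhammer c n"
    using Cons.prems[of c] by (simp add: pochhammer_Gamma Gamma_eq_zero_iff)
  thus ?case using Cons by simp
qed simp

lemma prod_list_Gamma_nonzero:
  fixes C :: "complex list"
  assumes "\<And>c. c \<in> set C \<Longrightarrow> c \<notin> \<int>\<^sub>\<le>\<^sub>0"
  shows "(\<Prod>c\<leftarrow>C. Gamma c) \<noteq> 0"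
  using assms by (auto simp: prod_list_zero_iff Gamma_eq_zero_iff)

lemma holomorphic_prod_list:
  assumes "\<And>c. c \<in> set C \<Longrightarrow> (\<lambda>s. f c s) holomorphic_on S"
  shows "(\<lambda>s. \<Prod>c\<leftarrow>C. f c s) holomorphic_on S"
  using assms by (induction C) (auto intro!: holomorphic_intros)

definition gamma_ratio :: "complex list \<Rightarrow> complex list \<Rightarrow> complex \<Rightarrow> complex" where
  "gamma_ratio C D s = (\<Prod>c\<leftarrow>C. Gamma (c + s)) / (\<Prod>d\<leftarrow>D. Gamma (d + s))"

text \<open>The denominator becomes a product of entire functions, so only the poles of the
  numerator restrict holomorphy. The default value of \<open>Gamma\<close> makes the identity hold
  at the poles of the denominator too.\<close>

lemma gamma_ratio_eq_rGamma: "gamma_ratio C D s = (\<Prod>c\<leftarrow>C. Gamma (c + s)) * (\<Prod>d\<leftarrow>D. rGamma (d + s))"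
proof -
  have "(\<Prod>d\<leftarrow>D. rGamma (d + s)) = inverse (\<Prod>d\<leftarrow>D. Gamma (d + s))"
    by (induction D) (simp_all add: rGamma_inverse_Gamma)
  thus ?thesis by (simp add: gamma_ratio_def divide_inverse)
qed

lemma holomorphic_gamma_ratio:
  assumes "\<And>c s. c \<in> set C \<Longrightarrow> s \<in> S \<Longrightarrow> c + s \<notin> \<int>\<^sub>\<le>\<^sub>0"
  shows "gamma_ratio C D holomorphic_on S"
  unfolding gamma_ratio_eq_rGamma[abs_def]
  by (intro holomorphic_on_mult holomorphic_prod_list holomorphic_Gamma' holomorphic_rGamma' holomorphic_intros)
    (use assms in auto)

text \<open>Equally many Gamma functions above and below leave only a power of |s|. The exponent is
  capped at 1/2 because the oscillatory estimates need \<epsilon> < 1, while the excess may be any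
  positive number.\<close>

lemma mellin_kernel_gamma_ratio:
  assumes len: "length C = length D" and C: "C \<noteq> []"
    and excess: "Re (sum_list C) < Re (sum_list D)"
  shows "mellin_kernel (gamma_ratio C D) (- Min (Re ` set C)) (min (Re (sum_list D - sum_list C)) (1 / 2))"
proof
  let ?\<alpha> = "- Min (Re ` set C)" and ?\<epsilon> = "min (Re (sum_list D - sum_list C)) (1 / 2)"
  show "0 < ?\<epsilon>" "?\<epsilon> < 1" using excess by auto
  show holo: "gamma_ratio C D holomorphic_on {s. ?\<alpha> < Re s}"
  proof (rule holomorphic_gamma_ratio)
    fix c s assume "c \<in> set C" "s \<in> {s. ?\<alpha> < Re s}"
    moreover from this have "Min (Re ` set C) \<le> Re c" by (intro Min_le) auto
    ultimately have "0 < Re (c + s)" by (simp add: less_eq_real_def) linarith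
    thus "c + s \<notin> \<int>\<^sub>\<le>\<^sub>0" using Re_nonpos_Ints[of "c + s"] by linarith
  qed
  obtain M R where MR: "0 < R" "0 \<le> M" "\<And>c. c \<in> set C \<Longrightarrow> norm c < R"
    "\<And>s. R \<le> norm s \<Longrightarrow> - norm s / 2 \<le> Re s \<Longrightarrow>
       norm ((\<Prod>c\<leftarrow>C. Gamma (c + s)) / (\<Prod>d\<leftarrow>D. Gamma (d + s)))
         \<le> M * norm s powr Re (sum_list C - sum_list D)"
    by (rule Gamma_prod_ratio_bound[OF len]) blast
  \<comment> \<open>Doubling R gives |s + n| >= |s| / 2 >= R > |c|, so s + n never equals
    -c.\<close>
  have holo': "gamma_ratio C D holomorphic_on {s. 2 * R \<le> norm s \<and> - norm s / 2 \<le> Re s}"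
  proof (rule holomorphic_gamma_ratio)
    fix c s assume c: "c \<in> set C" and s: "s \<in> {s. 2 * R \<le> norm s \<and> - norm s / 2 \<le> Re s}"
    show "c + s \<notin> \<int>\<^sub>\<le>\<^sub>0"
    proof
      assume "c + s \<in> \<int>\<^sub>\<le>\<^sub>0"
      then obtain n where "c + s = - of_nat n" by (elim nonpos_Ints_cases')
      hence "s + of_nat n = - c" by (simp add: algebra_simps eq_neg_iff_add_eq_0)
      hence "norm (s + of_nat n) < R" using MR(3)[OF c] by simp
      thus False using norm_add_of_nat_sector'[of s n] s by simp
    qed
  qed
  show "\<exists>K\<ge>0. \<forall>s. \<gamma> \<le> Re s \<longrightarrow> norm (gamma_ratio C D s) \<le> K * (1 + norm s) powr (- ?\<epsilon>) \<and>
        norm (deriv (gamma_ratio C D) s) \<le> K * (1 + norm s) powr (- 1 - ?\<epsilon>)" if "?\<alpha> < \<gamma>" for \<gamma>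
  proof (rule decay_on_half_plane[OF holo holo'])
    show "norm (gamma_ratio C D s) \<le> M * norm s powr (- Re (sum_list D - sum_list C))"
      if "2 * R \<le> norm s" "- norm s / 2 \<le> Re s" for s
      using MR(4)[of s] that MR(1) by (simp add: gamma_ratio_def)
  qed (use that MR excess in auto)
qed

theorem theorem8:
  fixes \<sigma> z :: complex and A B :: "complex list" and q :: nat
  assumes "length A = q" and "length B = q"
    and "\<forall>b\<in>set B. b \<notin> \<int>\<^sub>\<le>\<^sub>0"
    and "Re (\<Sum>i<q. B ! i - A ! i) + 1 > Re \<sigma>"
    and "\<forall>i<q. Re (A ! i) > 0"
    and "Re \<sigma> > 0"
    and "1 + z \<noteq> 0" and "\<bar>Arg (1 + z)\<bar> < pi"
  shows "(\<lambda>s. rho1 \<sigma> A B s / (1 + of_real s * z)) absolutely_integrable_on {0..1} \<and>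
         hypergeo (\<sigma> # A) B (- z) =
           integral {0..1} (\<lambda>s. rho1 \<sigma> A B s / (1 + of_real s * z))"
proof -
  define C where "C = \<sigma> # A"
  define D where "D = 1 # B"
  define \<alpha> where "\<alpha> = - Min (Re ` set C)"
  define \<epsilon> where "\<epsilon> = min (Re (sum_list D - sum_list C)) (1 / 2)"
  have Re_C: "0 < Re c" if "c \<in> set C" for c
    using that assms by (auto simp: C_def in_set_conv_nth)
  hence C_nz: "c \<notin> \<int>\<^sub>\<le>\<^sub>0" if "c \<in> set C" for c
    using that Re_nonpos_Ints[of c] by (meson not_less)
  have D_nz: "d \<notin> \<int>\<^sub>\<le>\<^sub>0" if "d \<in> set D" for d
    using that assms(3) by (auto simp: D_def)
  have "0 < Min (Re ` set C)"
    using Re_C by (subst Min_gr_iff) (auto simp: C_def)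
  \<comment> \<open>Puts every s = n, including n = 0, into the half-plane of the Mellin
    formula.\<close>
  hence \<alpha>: "\<alpha> < 0" by (simp add: \<alpha>_def)
  have "(\<Sum>i<q. B ! i - A ! i) = sum_list B - sum_list A"
    using sum_nth_diff[of A B] assms(1,2) by simp
  \<comment> \<open>The leading entries 1 of D and \<sigma> of C account for the remaining terms of
    the hypothesis.\<close>
  hence excess: "Re (sum_list C) < Re (sum_list D)"
    using assms(4) by (simp add: C_def D_def)
  interpret mellin_kernel "gamma_ratio C D" \<alpha> \<epsilon>
    unfolding \<alpha>_def \<epsilon>_def
    by (rule mellin_kernel_gamma_ratio) (use assms excess in \<open>auto simp: C_def D_def\<close>)
  have "meijer_G_trunc D C = trunc"
    by (intro ext) (simp add: meijer_G_trunc_def trunc_def gamma_ratio_def)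
  hence G: "meijer_G D C x = inverse_mellin x" for x
    unfolding meijer_G_def inverse_mellin_def by (simp only: flip: \<alpha>_def)
  define K where "K = (\<Prod>d\<leftarrow>D. Gamma d) / (\<Prod>c\<leftarrow>C. Gamma c)"
  have K: "K = 1 / Gamma \<sigma> * (\<Prod>i<length A. Gamma (B ! i) / Gamma (A ! i))"
    using prod_nth_divide[of A B Gamma] assms(1,2) by (simp add: K_def C_def D_def)
  \<comment> \<open>The factor 1/x is kept as x powr (0 - 1), to match
    \<open>mellin_inverse_mellin\<close> at s = 0.\<close>
  have rho: "rho1 \<sigma> A B x = K * (of_real (x powr (0 - 1)) * inverse_mellin x)" if "0 < x" for x
    using that unfolding rho1_def K[symmetric] C_def[symmetric] D_def[symmetric] G
    by (simp add: powr_minus field_simps)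
  interpret stieltjes "rho1 \<sigma> A B"
  proof
    have "set_integrable lborel {0<..<1} (\<lambda>x. K * (of_real (x powr (0 - 1)) * inverse_mellin x))"
      by (rule set_integrable_mult_right) (intro mellin_inverse_mellin(1) \<alpha>)
    thus "set_integrable lborel {0<..<1} (rho1 \<sigma> A B)"
      by (rule set_integrable_cong[THEN iffD1, rotated -1]) (auto simp: rho)
  qed
  have moment: "(LINT x:{0<..<1}|lborel. rho1 \<sigma> A B x * of_real x ^ n) = fps_nth (fps_hypergeo C B 1) n" for n
  proof -
    have "(LINT x:{0<..<1}|lborel. rho1 \<sigma> A B x * of_real x ^ n) =
       (LINT x:{0<..<1}|lborel. K * (of_real (x powr (real n - 1)) * inverse_mellin x))"
    proof (intro set_lebesgue_integral_cong allI impI)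
      fix x :: real assume x: "x \<in> {0<..<1}"
      have "x powr (real n - 1) = x powr (0 - 1) * x ^ n"
        using x by (simp add: powr_diff powr_minus powr_realpow divide_simps)
      thus "rho1 \<sigma> A B x * of_real x ^ n = K * (of_real (x powr (real n - 1)) * inverse_mellin x)"
        using x by (simp add: rho mult_ac)
    qed simp
    also have "\<dots> = K * (LINT x:{0<..<1}|lborel. of_real (x powr (real n - 1)) * inverse_mellin x)"
      by (rule set_integral_mult_right)
    also have "(LINT x:{0<..<1}|lborel. of_real (x powr (real n - 1)) * inverse_mellin x) = gamma_ratio C D (of_nat n)"
      using mellin_inverse_mellin(2)[of "real n"] \<alpha> by simp
    also have "K * gamma_ratio C D (of_nat n) = (\<Prod>c\<leftarrow>C. pochhammer c n) / (\<Prod>d\<leftarrow>D. pochhammer d n)"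
      unfolding K_def gamma_ratio_def
      using prod_list_Gamma_add_of_nat[of C n] prod_list_Gamma_add_of_nat[of D n] C_nz D_nz
        prod_list_Gamma_nonzero[of C] prod_list_Gamma_nonzero[of D] by simp
    \<comment> \<open>The leading 1 of D supplies n! as \<open>pochhammer 1 n\<close>.\<close>
    also have "\<dots> = fps_nth (fps_hypergeo C B 1) n"
      unfolding fps_hypergeo_nth foldl_mult_eq_prod_list by (simp add: D_def mult_ac flip: pochhammer_fact)
    finally show ?thesis .
  qed
  have z: "- z \<in> cut_plane"
  proof (rule ccontr)
    assume "- z \<notin> cut_plane"
    \<comment> \<open>The hypothesis 1 + z \<noteq> 0 excludes the branch point -z = 1; the bound on
      \<open>Arg\<close> excludes the rest of the cut.\<close>
    hence "Im (1 + z) = 0" "Re (1 + z) < 0"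
      using assms(7) by (auto simp: mem_cut_plane_iff complex_eq_iff)
    hence "Arg (1 + z) = pi" using Arg_eq_pi by blast
    thus False using assms(8) by simp
  qed
  have "hypergeo C B (- z) = transform (- z)"
  proof (rule hypergeo_eqI[OF transform_holomorphic _ z])
    fix u :: complex assume "norm u < 1"
    from transform_sums[OF this] show "transform u = eval_fps (fps_hypergeo C B 1) u"
      by (simp add: moment eval_fps_def sums_iff)
  qed
  moreover have int: "set_integrable lborel {0<..<1} (\<lambda>s. rho1 \<sigma> A B s / (1 + of_real s * z))"
    using integrable_transform[OF z] by simp
  moreover have "transform (- z) = integral {0<..<1} (\<lambda>s. rho1 \<sigma> A B s / (1 + of_real s * z))"
    using set_borel_integral_eq_integral(2)[OF int] by (simp add: transform_def)
  \<comment> \<open>The endpoints, where nothing is known about \<open>rho1\<close>, do not affect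
    the integral.\<close>
  moreover have "integral {0<..<1} (\<lambda>s. rho1 \<sigma> A B s / (1 + of_real s * z)) =
      integral {0..1} (\<lambda>s. rho1 \<sigma> A B s / (1 + of_real s * z))"
    unfolding integral_def integrable_on_def has_integral_Icc_iff_Ioo ..
  \<comment> \<open>Absolute integrability refers to the completed measure, so integrability is
    transferred from \<open>lborel\<close>.\<close>
  moreover have "(\<lambda>s. rho1 \<sigma> A B s / (1 + of_real s * z)) absolutely_integrable_on {0..1}"
    unfolding absolutely_integrable_on_Icc_iff_Ioo
    using int unfolding set_integrable_def
    by (subst integrable_completion) (auto intro: borel_measurable_integrable)
  ultimately show ?thesis by (simp add: C_def)
qed

end
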